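(* Let $k$ be a field of characteristic $p>2$, let $\mathfrak g$ be a restricted Lie superalgebra over $k$, and let $M$ be a strongly abelian restricted Lie superalgebra on which $\mathfrak g$ operates (i.e. a restricted $\mathfrak g$-module, regarded as a restricted Lie superalgebra with zero bracket and zero $p$-map). Let $\mathrm H^2_0(\mathfrak g,M)\subseteq\mathrm H^2(\mathfrak g,M)$ be the subset corresponding to the similarity classes of restricted extensions of $M$ by $\mathfrak g$, and let $\Phi:\mathrm H^2(\mathfrak g,M)\to S(\mathfrak g_{\bar 0},\mathrm H^1(\mathfrak g,M))$ be the linear map defined in the context. Then $$\mathrm H^2_0(\mathfrak g,M)=\mathrm{Ker}\,\Phi .$$
   Context: Conventions. All vector spaces are $\mathbb Z_2$-graded, all linear maps and cochains are even, $|v|$ is the degree of a homogeneous element. A Lie superalgebra over $k$ is understood in the usual sense (if $p=3$ this includes $[y,[y,y]]=0$ for odd $y$). $S(V,W)$ is the $k$-space of $p$-semilinear maps ($f(\alpha v_1+v_2)=\alpha^pf(v_1)+f(v_2)$). A restricted Lie superalgebra is a Lie superalgebra $\mathfrak g$ with a map $x\mapsto x^{[p]}$, $\mathfrak g_{\bar 0}\to\mathfrak g_{\bar 0}$, such that (a) $(cx)^{[p]}=c^px^{[p]}$; (b) $[x^{[p]},y]=(\mathrm{ad}\,x)^p(y)$ for $x\in\mathfrak g_{\bar 0}$, $y\in\mathfrak g$; (c) $(x+y)^{[p]}=x^{[p]}+y^{[p]}+\sum_{i=1}^{p-1}s_i(x,y)$, where $i\,s_i(x,y)$ is the coefficient of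 $\lambda^{i-1}$ in $(\mathrm{ad}(\lambda x+y))^{p-1}(x)$. It is strongly abelian if its bracket is zero and $x^{[p]}=0$ for all even $x$. A $\mathfrak g$-module $M$ is restricted if $x^p\cdot m=x^{[p]}\cdot m$ for $x\in\mathfrak g_{\bar 0}$. $\mathrm H^1(\mathfrak g,M)$ is the space of even linear $h:\mathfrak g\to M$ with $h([x_1,x_2])=x_1\cdot h(x_2)-(-1)^{|x_1||x_2|}x_2\cdot h(x_1)$, modulo the maps $x\mapsto x\cdot m$, $m\in M_{\bar 0}$. Let $U(\mathfrak g)^+$ be the ideal of the universal enveloping algebra $U(\mathfrak g)$ generated by $\mathfrak g$. $\mathrm H^2(\mathfrak g,M)$ is the space of $2$-cocycles, i.e. even bilinear $g:U(\mathfrak g)^+\times U(\mathfrak g)^+\to M$ with $s_1\cdot g(s_2,s_3)-g(s_1s_2,s_3)+g(s_1,s_2s_3)=0$, modulo the coboundaries $(s_1,s_2)\mapsto s_1\cdot h(s_2)-h(s_1s_2)$ with $h:U(\mathfrak g)^+\to M$ even linear. An extension of $M$ by $\mathfrak g$ is a pair $(E,\phi)$ with $E$ a Lie superalgebra containing $M$ as an ideal and $\phi:E\to\mathfrak g$ a surjective Lie superalgebra homomorphism with kernel $M$, inducing the given $\mathfrak g$-module structure on $M$. Two extensions are equivalent as ordinary extensions (for restricted extensions: similar) if there is a Lie superalgebra isomorphism $\alpha:E\to E'$ fixing $M$ pointwise with $\phi'\alpha=\phi$. The extension is restricted if $E$ is a restricted Lie superalgebra, $M$ (with its zero $p$-map)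 is an ideal of it, and $\phi$ respects $p$-maps. The class of a $2$-cocycle $g$ corresponds to the ordinary equivalence class of $E_g=\mathfrak g\oplus M$, $\phi_g(x,m)=x$, with bracket $$[(x_1,m_1),(x_2,m_2)]=([x_1,x_2],\;x_1\cdot m_2-(-1)^{|x_1||x_2|}x_2\cdot m_1+g(x_1,x_2)-(-1)^{|x_1||x_2|}g(x_2,x_1)).$$ $\mathrm H^2_0(\mathfrak g,M)$ is the set of classes of those $g$ for which $(E_g,\phi_g)$ is equivalent, as an ordinary extension, to a restricted extension. $\Phi$ sends the class of a $2$-cocycle $g$ to the $p$-semilinear map sending $x\in\mathfrak g_{\bar 0}$ to the class in $\mathrm H^1(\mathfrak g,M)$ of $x_1\mapsto g(x^p-x^{[p]},x_1)-g(x_1,x^p-x^{[p]})$ ($x_1\in\mathfrak g$, $x^p$ computed in $U(\mathfrak g)$). *)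

theory Defs
  imports
    "HOL-Library.Z2"
    "HOL-Library.Product_Plus"
    "HOL-Library.Poly_Mapping"
    "HOL-Computational_Algebra.Polynomial"
    "HOL-Algebra.QuotRing"
    "HOL-Algebra.Algebraic_Closure_Type"
begin

section \<open>Super vector spaces and Lie superalgebras\<close>

text \<open>
  The underlying set of a super vector space is a whole type; \<open>scl\<close> is the scalar multiplication
  and \<open>grade V a\<close> the subspace of elements of degree \<open>a \<in> \<int>/2\<close> (zero has both degrees).
\<close>

record ('k, 'v) super_space =
  scl :: "'k \<Rightarrow> 'v \<Rightarrow> 'v"
  grade :: "bit \<Rightarrow> 'v set"

record ('k, 'v) lie_super = "('k, 'v) super_space" +
  brkt :: "'v \<Rightarrow> 'v \<Rightarrow> 'v"

record ('k, 'v) restricted_lie_super = "('k, 'v) lie_super" +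
  pmap :: "'v \<Rightarrow> 'v"

locale super_vector_space =
  fixes V :: "('k::field, 'v::ab_group_add, 'z) super_space_scheme"
  assumes vector_space: "vector_space (scl V)"
    and grade_subspace: "module.subspace (scl V) (grade V a)"
    and grade_disjoint: "grade V 0 \<inter> grade V 1 = {0}"
    and grade_sum: "\<exists>v0\<in>grade V 0. \<exists>v1\<in>grade V 1. v = v0 + v1"

definition component :: "('k, 'v::ab_group_add, 'z) super_space_scheme \<Rightarrow> bit \<Rightarrow> 'v \<Rightarrow> 'v" where
  "component V a v = (THE u. u \<in> grade V a \<and> v - u \<in> grade V (a + 1))"

text \<open>The sign rule: \<open>koszul a b v\<close> is $(-1)^{ab}v$.\<close>

definition koszul :: "bit \<Rightarrow> bit \<Rightarrow> 'v::ab_group_add \<Rightarrow> 'v" where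
  "koszul a b v = (if a = 1 \<and> b = 1 then - v else v)"

definition even_linear ::
  "('k::field, 'v::ab_group_add, 'y) super_space_scheme \<Rightarrow>
   ('k, 'w::ab_group_add, 'z) super_space_scheme \<Rightarrow> ('v \<Rightarrow> 'w) \<Rightarrow> bool" where
  "even_linear V W f \<longleftrightarrow>
     Vector_Spaces.linear (scl V) (scl W) f \<and> (\<forall>a. f ` grade V a \<subseteq> grade W a)"

locale lie_superalgebra = super_vector_space L
  for L :: "('k::field, 'v::ab_group_add, 'z) lie_super_scheme" +
  assumes brkt_linear_right: "Vector_Spaces.linear (scl L) (scl L) (\<lambda>y. brkt L x y)"
    and brkt_linear_left: "Vector_Spaces.linear (scl L) (scl L) (\<lambda>x. brkt L x y)"
    and brkt_grade: "\<lbrakk>x \<in> grade L a; y \<in> grade L b\<rbrakk> \<Longrightarrow> brkt L x y \<in> grade L (a + b)"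
    and skew: "\<lbrakk>x \<in> grade L a; y \<in> grade L b\<rbrakk> \<Longrightarrow> brkt L x y = - koszul a b (brkt L y x)"
    and jacobi: "\<lbrakk>x \<in> grade L a; y \<in> grade L b; z \<in> grade L c\<rbrakk> \<Longrightarrow>
      brkt L x (brkt L y z) = brkt L (brkt L x y) z + koszul a b (brkt L y (brkt L x z))"
    and cubic: "\<lbrakk>CHAR('k) = 3; y \<in> grade L 1\<rbrakk> \<Longrightarrow> brkt L y (brkt L y y) = 0"

text \<open>
  Elements of $L \otimes k[\lambda]$ are represented by polynomials with coefficients in \<open>L\<close>;
  \<open>ad_pencil L x y\<close> is $\mathrm{ad}(\lambda x + y)$ acting on them.
\<close>

definition ad_pencil ::
  "('k, 'v::ab_group_add, 'z) lie_super_scheme \<Rightarrow> 'v \<Rightarrow> 'v \<Rightarrow> 'v poly \<Rightarrow> 'v poly" where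
  "ad_pencil L x y q = pCons 0 (map_poly (brkt L x) q) + map_poly (brkt L y) q"

definition jacobson_s ::
  "('k::field, 'v::ab_group_add, 'z) lie_super_scheme \<Rightarrow> nat \<Rightarrow> 'v \<Rightarrow> 'v \<Rightarrow> 'v" where
  "jacobson_s L i x y =
     scl L (inverse (of_nat i))
       (Polynomial.coeff ((ad_pencil L x y ^^ (CHAR('k) - 1)) [:x:]) (i - 1))"

text \<open>The \<open>p\<close>-map is only meaningful on the even part; its values elsewhere are irrelevant.\<close>

locale restricted_lie_superalgebra = lie_superalgebra L
  for L :: "('k::field, 'v::ab_group_add, 'z) restricted_lie_super_scheme" +
  assumes pmap_even: "x \<in> grade L 0 \<Longrightarrow> pmap L x \<in> grade L 0"
    and pmap_scl: "x \<in> grade L 0 \<Longrightarrow> pmap L (scl L c x) = scl L (c ^ CHAR('k)) (pmap L x)"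
    and brkt_pmap: "x \<in> grade L 0 \<Longrightarrow> brkt L (pmap L x) y = (brkt L x ^^ CHAR('k)) y"
    and pmap_add: "\<lbrakk>x \<in> grade L 0; y \<in> grade L 0\<rbrakk> \<Longrightarrow>
      pmap L (x + y) = pmap L x + pmap L y + (\<Sum>i = 1..CHAR('k) - 1. jacobson_s L i x y)"

definition strongly_abelian :: "('k, 'v::ab_group_add, 'z) restricted_lie_super_scheme \<Rightarrow> bool" where
  "strongly_abelian L \<longleftrightarrow> (\<forall>x y. brkt L x y = 0) \<and> (\<forall>x\<in>grade L 0. pmap L x = 0)"

locale lie_super_module = G: lie_superalgebra G + M: super_vector_space M
  for G :: "('k::field, 'g::ab_group_add, 'y) lie_super_scheme"
    and M :: "('k, 'm::ab_group_add, 'z) super_space_scheme"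
    and act :: "'g \<Rightarrow> 'm \<Rightarrow> 'm" +
  assumes act_linear_right: "Vector_Spaces.linear (scl M) (scl M) (\<lambda>m. act x m)"
    and act_linear_left: "Vector_Spaces.linear (scl G) (scl M) (\<lambda>x. act x m)"
    and act_grade: "\<lbrakk>x \<in> grade G a; m \<in> grade M b\<rbrakk> \<Longrightarrow> act x m \<in> grade M (a + b)"
    and act_brkt: "\<lbrakk>x \<in> grade G a; y \<in> grade G b\<rbrakk> \<Longrightarrow>
      act (brkt G x y) m = act x (act y m) - koszul a b (act y (act x m))"

locale restricted_module =
  G: restricted_lie_superalgebra G + lie_super_module G M act
  for G :: "('k::field, 'g::ab_group_add, 'y) restricted_lie_super_scheme"
    and M :: "('k, 'm::ab_group_add, 'z) super_space_scheme"
    and act :: "'g \<Rightarrow> 'm \<Rightarrow> 'm" +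
  assumes act_pmap: "x \<in> grade G 0 \<Longrightarrow> (act x ^^ CHAR('k)) m = act (pmap G x) m"

definition lie_super_hom ::
  "('k::field, 'v::ab_group_add, 'y) lie_super_scheme \<Rightarrow>
   ('k, 'w::ab_group_add, 'z) lie_super_scheme \<Rightarrow> ('v \<Rightarrow> 'w) \<Rightarrow> bool" where
  "lie_super_hom L L' f \<longleftrightarrow>
     even_linear L L' f \<and> (\<forall>x y. f (brkt L x y) = brkt L' (f x) (f y))"


section \<open>The universal enveloping algebra\<close>

datatype 'a word = Word (letters: "'a list")

instantiation word :: (type) monoid_add
begin

definition zero_word :: "'a word" where
  "zero_word = Word []"

definition plus_word :: "'a word \<Rightarrow> 'a word \<Rightarrow> 'a word" where
  "plus_word u v = Word (letters u @ letters v)"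

instance
  by standard (simp_all add: zero_word_def plus_word_def)

end

text \<open>
  \<open>'g word \<Rightarrow>\<^sub>0 'k\<close> is the free associative unital algebra on the set underlying $\mathfrak g$.
  Dividing out the linearity relations turns it into the tensor algebra of $\mathfrak g$, and the
  bracket relations turn that into $U(\mathfrak g)$.
\<close>

type_synonym ('k, 'g) free_alg = "'g word \<Rightarrow>\<^sub>0 'k"

definition free_ring :: "('k::field, 'g) free_alg ring" where
  "free_ring = ring_of_type_algebra"

definition free_scl :: "'k::field \<Rightarrow> ('k, 'g) free_alg \<Rightarrow> ('k, 'g) free_alg" where
  "free_scl c f = Poly_Mapping.single 0 c * f"

definition free_var :: "'g \<Rightarrow> ('k::field, 'g) free_alg" where
  "free_var x = Poly_Mapping.single (Word [x]) 1"

definition free_grade ::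
  "('k::field, 'g, 'z) super_space_scheme \<Rightarrow> bit \<Rightarrow> ('k, 'g) free_alg set" where
  "free_grade G a = module.span free_scl
     {Poly_Mapping.single (Word xs) 1 | xs bs.
        list_all2 (\<lambda>x b. x \<in> grade G b) xs bs \<and> sum_list bs = a}"

definition env_relations ::
  "('k::field, 'g::ab_group_add, 'z) lie_super_scheme \<Rightarrow> ('k, 'g) free_alg set" where
  "env_relations G =
     {free_var (x + y) - free_var x - free_var y | x y. True} \<union>
     {free_var (scl G c x) - free_scl c (free_var x) | c x. True} \<union>
     {free_var (brkt G x y)
        - (free_var x * free_var y - koszul a b (free_var y * free_var x)) | x y a b.
        x \<in> grade G a \<and> y \<in> grade G b}"

definition env_ideal ::
  "('k::field, 'g::ab_group_add, 'z) lie_super_scheme \<Rightarrow> ('k, 'g) free_alg set" where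
  "env_ideal G = Idl\<^bsub>free_ring\<^esub> (env_relations G)"

definition Env ::
  "('k::field, 'g::ab_group_add, 'z) lie_super_scheme \<Rightarrow> ('k, 'g) free_alg set ring" where
  "Env G = free_ring Quot env_ideal G"

definition env_class ::
  "('k::field, 'g::ab_group_add, 'z) lie_super_scheme \<Rightarrow> ('k, 'g) free_alg \<Rightarrow> ('k, 'g) free_alg set"
  where "env_class G f = env_ideal G +>\<^bsub>free_ring\<^esub> f"

definition env_in ::
  "('k::field, 'g::ab_group_add, 'z) lie_super_scheme \<Rightarrow> 'g \<Rightarrow> ('k, 'g) free_alg set" where
  "env_in G x = env_class G (free_var x)"

definition env_scl ::
  "('k::field, 'g::ab_group_add, 'z) lie_super_scheme \<Rightarrow> 'k \<Rightarrow>
   ('k, 'g) free_alg set \<Rightarrow> ('k, 'g) free_alg set" where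
  "env_scl G c s = env_class G (Poly_Mapping.single 0 c) \<otimes>\<^bsub>Env G\<^esub> s"

definition env_grade ::
  "('k::field, 'g::ab_group_add, 'z) lie_super_scheme \<Rightarrow> bit \<Rightarrow> ('k, 'g) free_alg set set" where
  "env_grade G a = env_class G ` free_grade G a"

definition Env_plus ::
  "('k::field, 'g::ab_group_add, 'z) lie_super_scheme \<Rightarrow> ('k, 'g) free_alg set set" where
  "Env_plus G = Idl\<^bsub>Env G\<^esub> (range (env_in G))"

definition free_act ::
  "('k::field, 'm::ab_group_add, 'z) super_space_scheme \<Rightarrow> ('g \<Rightarrow> 'm \<Rightarrow> 'm) \<Rightarrow>
   ('k, 'g) free_alg \<Rightarrow> 'm \<Rightarrow> 'm" where
  "free_act M act f m =
     (\<Sum>w\<in>Poly_Mapping.keys f. scl M (Poly_Mapping.lookup f w) (foldr act (letters w) m))"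

text \<open>The action of $U(\mathfrak g)$ on a module: the value of \<open>free_act\<close> on any representative.\<close>

definition env_act ::
  "('k::field, 'm::ab_group_add, 'z) super_space_scheme \<Rightarrow> ('g \<Rightarrow> 'm \<Rightarrow> 'm) \<Rightarrow>
   ('k, 'g) free_alg set \<Rightarrow> 'm \<Rightarrow> 'm" where
  "env_act M act s m = the_elem ((\<lambda>f. free_act M act f m) ` s)"


section \<open>Cohomology\<close>

text \<open>Cocycles form groups under pointwise addition, written multiplicatively in HOL-Algebra.\<close>

definition Z1 ::
  "('k::field, 'g::ab_group_add, 'y) lie_super_scheme \<Rightarrow>
   ('k, 'm::ab_group_add, 'z) super_space_scheme \<Rightarrow> ('g \<Rightarrow> 'm \<Rightarrow> 'm) \<Rightarrow> ('g \<Rightarrow> 'm) monoid" where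
  "Z1 G M act =
     \<lparr>carrier = {h. even_linear G M h \<and>
        (\<forall>a b. \<forall>x\<in>grade G a. \<forall>y\<in>grade G b.
           h (brkt G x y) = act x (h y) - koszul a b (act y (h x)))},
      monoid.mult = (\<lambda>f h x. f x + h x),
      monoid.one = (\<lambda>x. 0)\<rparr>"

definition B1 ::
  "('k, 'm, 'z) super_space_scheme \<Rightarrow> ('g \<Rightarrow> 'm \<Rightarrow> 'm) \<Rightarrow> ('g \<Rightarrow> 'm) set" where
  "B1 M act = {\<lambda>x. act x m | m. m \<in> grade M 0}"

definition H1 ::
  "('k::field, 'g::ab_group_add, 'y) lie_super_scheme \<Rightarrow>
   ('k, 'm::ab_group_add, 'z) super_space_scheme \<Rightarrow> ('g \<Rightarrow> 'm \<Rightarrow> 'm) \<Rightarrow> ('g \<Rightarrow> 'm) set monoid" where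
  "H1 G M act = Z1 G M act Mod B1 M act"

definition H1_class ::
  "('k::field, 'g::ab_group_add, 'y) lie_super_scheme \<Rightarrow>
   ('k, 'm::ab_group_add, 'z) super_space_scheme \<Rightarrow> ('g \<Rightarrow> 'm \<Rightarrow> 'm) \<Rightarrow>
   ('g \<Rightarrow> 'm) \<Rightarrow> ('g \<Rightarrow> 'm) set" where
  "H1_class G M act h = B1 M act #>\<^bsub>Z1 G M act\<^esub> h"

definition H1_scl ::
  "('k::field, 'g::ab_group_add, 'y) lie_super_scheme \<Rightarrow>
   ('k, 'm::ab_group_add, 'z) super_space_scheme \<Rightarrow> ('g \<Rightarrow> 'm \<Rightarrow> 'm) \<Rightarrow>
   'k \<Rightarrow> ('g \<Rightarrow> 'm) set \<Rightarrow> ('g \<Rightarrow> 'm) set" where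
  "H1_scl G M act c C = (\<Union>h\<in>C. H1_class G M act (\<lambda>x. scl M c (h x)))"

definition even_linear_cochain ::
  "('k::field, 'g::ab_group_add, 'y) lie_super_scheme \<Rightarrow>
   ('k, 'm::ab_group_add, 'z) super_space_scheme \<Rightarrow> (('k, 'g) free_alg set \<Rightarrow> 'm) \<Rightarrow> bool" where
  "even_linear_cochain G M h \<longleftrightarrow>
     (\<forall>s\<in>Env_plus G. \<forall>t\<in>Env_plus G. h (s \<oplus>\<^bsub>Env G\<^esub> t) = h s + h t) \<and>
     (\<forall>c. \<forall>s\<in>Env_plus G. h (env_scl G c s) = scl M c (h s)) \<and>
     (\<forall>a. \<forall>s\<in>Env_plus G \<inter> env_grade G a. h s \<in> grade M a)"

text \<open>
  A map on $U(\mathfrak g)^+ \times U(\mathfrak g)^+$ is represented by its extension by zero, so that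
  equal maps are represented by equal functions.
\<close>

definition even_bilinear_cochain ::
  "('k::field, 'g::ab_group_add, 'y) lie_super_scheme \<Rightarrow>
   ('k, 'm::ab_group_add, 'z) super_space_scheme \<Rightarrow>
   (('k, 'g) free_alg set \<Rightarrow> ('k, 'g) free_alg set \<Rightarrow> 'm) \<Rightarrow> bool" where
  "even_bilinear_cochain G M g \<longleftrightarrow>
     (\<forall>s t. s \<notin> Env_plus G \<or> t \<notin> Env_plus G \<longrightarrow> g s t = 0) \<and>
     (\<forall>s\<in>Env_plus G. \<forall>t\<in>Env_plus G. \<forall>u\<in>Env_plus G.
        g (s \<oplus>\<^bsub>Env G\<^esub> t) u = g s u + g t u \<and> g u (s \<oplus>\<^bsub>Env G\<^esub> t) = g u s + g u t) \<and>
     (\<forall>c. \<forall>s\<in>Env_plus G. \<forall>t\<in>Env_plus G.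
        g (env_scl G c s) t = scl M c (g s t) \<and> g s (env_scl G c t) = scl M c (g s t)) \<and>
     (\<forall>a b. \<forall>s\<in>Env_plus G \<inter> env_grade G a. \<forall>t\<in>Env_plus G \<inter> env_grade G b.
        g s t \<in> grade M (a + b))"

definition Z2 ::
  "('k::field, 'g::ab_group_add, 'y) lie_super_scheme \<Rightarrow>
   ('k, 'm::ab_group_add, 'z) super_space_scheme \<Rightarrow> ('g \<Rightarrow> 'm \<Rightarrow> 'm) \<Rightarrow>
   (('k, 'g) free_alg set \<Rightarrow> ('k, 'g) free_alg set \<Rightarrow> 'm) monoid" where
  "Z2 G M act =
     \<lparr>carrier = {g. even_bilinear_cochain G M g \<and>
        (\<forall>s\<in>Env_plus G. \<forall>t\<in>Env_plus G. \<forall>u\<in>Env_plus G.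
           env_act M act s (g t u) - g (s \<otimes>\<^bsub>Env G\<^esub> t) u + g s (t \<otimes>\<^bsub>Env G\<^esub> u) = 0)},
      monoid.mult = (\<lambda>f g s t. f s t + g s t),
      monoid.one = (\<lambda>s t. 0)\<rparr>"

definition B2 ::
  "('k::field, 'g::ab_group_add, 'y) lie_super_scheme \<Rightarrow>
   ('k, 'm::ab_group_add, 'z) super_space_scheme \<Rightarrow> ('g \<Rightarrow> 'm \<Rightarrow> 'm) \<Rightarrow>
   (('k, 'g) free_alg set \<Rightarrow> ('k, 'g) free_alg set \<Rightarrow> 'm) set" where
  "B2 G M act =
     {\<lambda>s t. if s \<in> Env_plus G \<and> t \<in> Env_plus G
            then env_act M act s (h t) - h (s \<otimes>\<^bsub>Env G\<^esub> t) else 0 | h.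
      even_linear_cochain G M h}"

definition H2 ::
  "('k::field, 'g::ab_group_add, 'y) lie_super_scheme \<Rightarrow>
   ('k, 'm::ab_group_add, 'z) super_space_scheme \<Rightarrow> ('g \<Rightarrow> 'm \<Rightarrow> 'm) \<Rightarrow>
   (('k, 'g) free_alg set \<Rightarrow> ('k, 'g) free_alg set \<Rightarrow> 'm) set monoid" where
  "H2 G M act = Z2 G M act Mod B2 G M act"

definition H2_class ::
  "('k::field, 'g::ab_group_add, 'y) lie_super_scheme \<Rightarrow>
   ('k, 'm::ab_group_add, 'z) super_space_scheme \<Rightarrow> ('g \<Rightarrow> 'm \<Rightarrow> 'm) \<Rightarrow>
   (('k, 'g) free_alg set \<Rightarrow> ('k, 'g) free_alg set \<Rightarrow> 'm) \<Rightarrow>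
   (('k, 'g) free_alg set \<Rightarrow> ('k, 'g) free_alg set \<Rightarrow> 'm) set" where
  "H2_class G M act g = B2 G M act #>\<^bsub>Z2 G M act\<^esub> g"


section \<open>Extensions\<close>

text \<open>
  The inclusion of \<open>M\<close> into \<open>E\<close> is an arbitrary injective homomorphism \<open>i\<close>; that its image is an
  ideal follows from its being the kernel of \<open>\<phi>\<close>.
\<close>

definition extension ::
  "('k::field, 'g::ab_group_add, 'x) lie_super_scheme \<Rightarrow>
   ('k, 'm::ab_group_add, 'y) lie_super_scheme \<Rightarrow> ('g \<Rightarrow> 'm \<Rightarrow> 'm) \<Rightarrow>
   ('k, 'e::ab_group_add, 'z) lie_super_scheme \<Rightarrow> ('m \<Rightarrow> 'e) \<Rightarrow> ('e \<Rightarrow> 'g) \<Rightarrow> bool" where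
  "extension G M act E i \<phi> \<longleftrightarrow>
     lie_superalgebra E \<and>
     lie_super_hom M E i \<and> inj i \<and>
     lie_super_hom E G \<phi> \<and> surj \<phi> \<and>
     {e. \<phi> e = 0} = range i \<and>
     (\<forall>e m. brkt E e (i m) = i (act (\<phi> e) m))"

definition restricted_extension ::
  "('k::field, 'g::ab_group_add, 'x) restricted_lie_super_scheme \<Rightarrow>
   ('k, 'm::ab_group_add, 'y) restricted_lie_super_scheme \<Rightarrow> ('g \<Rightarrow> 'm \<Rightarrow> 'm) \<Rightarrow>
   ('k, 'e::ab_group_add, 'z) restricted_lie_super_scheme \<Rightarrow> ('m \<Rightarrow> 'e) \<Rightarrow> ('e \<Rightarrow> 'g) \<Rightarrow> bool" where
  "restricted_extension G M act E i \<phi> \<longleftrightarrow>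
     extension G M act E i \<phi> \<and>
     restricted_lie_superalgebra E \<and>
     (\<forall>m\<in>grade M 0. pmap E (i m) = i (pmap M m)) \<and>
     (\<forall>e\<in>grade E 0. \<phi> (pmap E e) = pmap G (\<phi> e))"

definition equivalent_extensions ::
  "('k::field, 'e::ab_group_add, 'y) lie_super_scheme \<Rightarrow> ('m \<Rightarrow> 'e) \<Rightarrow> ('e \<Rightarrow> 'g) \<Rightarrow>
   ('k, 'f::ab_group_add, 'z) lie_super_scheme \<Rightarrow> ('m \<Rightarrow> 'f) \<Rightarrow> ('f \<Rightarrow> 'g) \<Rightarrow> bool" where
  "equivalent_extensions E i \<phi> E' i' \<phi>' \<longleftrightarrow>
     (\<exists>\<alpha>. bij \<alpha> \<and> lie_super_hom E E' \<alpha> \<and> \<alpha> \<circ> i = i' \<and> \<phi>' \<circ> \<alpha> = \<phi>)"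

text \<open>
  The bracket of $E_g$ is given by a formula for homogeneous elements (an element of degree \<open>a\<close> of
  $\mathfrak g \oplus M$ has both components of degree \<open>a\<close>) and extended biadditively.
\<close>

definition cocycle_brkt_hom ::
  "('k::field, 'g::ab_group_add, 'y) lie_super_scheme \<Rightarrow> ('g \<Rightarrow> 'm::ab_group_add \<Rightarrow> 'm) \<Rightarrow>
   (('k, 'g) free_alg set \<Rightarrow> ('k, 'g) free_alg set \<Rightarrow> 'm) \<Rightarrow>
   bit \<Rightarrow> bit \<Rightarrow> 'g \<times> 'm \<Rightarrow> 'g \<times> 'm \<Rightarrow> 'g \<times> 'm" where
  "cocycle_brkt_hom G act g a b = (\<lambda>(x1, m1) (x2, m2).
     (brkt G x1 x2,
      act x1 m2 - koszul a b (act x2 m1)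
        + g (env_in G x1) (env_in G x2) - koszul a b (g (env_in G x2) (env_in G x1))))"

definition cocycle_ext ::
  "('k::field, 'g::ab_group_add, 'y) lie_super_scheme \<Rightarrow>
   ('k, 'm::ab_group_add, 'z) super_space_scheme \<Rightarrow> ('g \<Rightarrow> 'm \<Rightarrow> 'm) \<Rightarrow>
   (('k, 'g) free_alg set \<Rightarrow> ('k, 'g) free_alg set \<Rightarrow> 'm) \<Rightarrow> ('k, 'g \<times> 'm) lie_super" where
  "cocycle_ext G M act g =
     \<lparr>scl = (\<lambda>c (x, m). (scl G c x, scl M c m)),
      grade = (\<lambda>a. grade G a \<times> grade M a),
      brkt = (\<lambda>(x, m) (y, n). \<Sum>a\<in>{0, 1}. \<Sum>b\<in>{0, 1}.
        cocycle_brkt_hom G act g a b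
          (component G a x, component M a m) (component G b y, component M b n))\<rparr>"

text \<open>
  A restricted extension equivalent to $E_g$ has an underlying abelian group isomorphic to
  $\mathfrak g \oplus M$, so letting \<open>E\<close> range over the structures on \<open>'g \<times> 'm\<close> loses no generality;
  see \<open>H2_0I\<close> below.
\<close>

definition H2_0 ::
  "('k::field, 'g::ab_group_add, 'y) restricted_lie_super_scheme \<Rightarrow>
   ('k, 'm::ab_group_add, 'z) restricted_lie_super_scheme \<Rightarrow> ('g \<Rightarrow> 'm \<Rightarrow> 'm) \<Rightarrow>
   (('k, 'g) free_alg set \<Rightarrow> ('k, 'g) free_alg set \<Rightarrow> 'm) set set" where
  "H2_0 G M act =
     {H2_class G M act g | g.
        g \<in> carrier (Z2 G M act) \<and>
        (\<exists>(E :: ('k, 'g \<times> 'm) restricted_lie_super) i \<phi>.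
           restricted_extension G M act E i \<phi> \<and>
           equivalent_extensions (cocycle_ext G M act g) (\<lambda>m. (0, m)) fst E i \<phi>)}"


locale transport =
  E: restricted_lie_superalgebra E
  for E :: "('k::field, 'e::ab_group_add, 'z) restricted_lie_super_scheme" +
  fixes \<alpha> :: "'f::ab_group_add \<Rightarrow> 'e" and \<beta> :: "'e \<Rightarrow> 'f"
  assumes inverse [simp]: "\<alpha> (\<beta> z) = z" "\<beta> (\<alpha> x) = x"
    and add: "\<alpha> (x + y) = \<alpha> x + \<alpha> y"
begin

definition T :: "('k, 'f) restricted_lie_super" where
  "T = \<lparr>scl = (\<lambda>c v. \<beta> (scl E c (\<alpha> v))), grade = (\<lambda>a. \<alpha> -` grade E a),
        brkt = (\<lambda>x y. \<beta> (brkt E (\<alpha> x) (\<alpha> y))),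
        pmap = (\<lambda>x. \<beta> (pmap E (\<alpha> x)))\<rparr>"

lemma eq_iff: "x = y \<longleftrightarrow> \<alpha> x = \<alpha> y"
  by (metis inverse(2))

lemma zero [simp]: "\<alpha> 0 = 0"
  using add[of 0 0] by simp

lemma minus [simp]: "\<alpha> (- x) = - \<alpha> x"
  using add[of "- x" x] by (simp add: eq_neg_iff_add_eq_0)

lemma sum [simp]: "\<alpha> (sum f A) = (\<Sum>a\<in>A. \<alpha> (f a))"
  by (induction A rule: infinite_finite_induct) (simp_all add: add)

lemma koszul [simp]: "\<alpha> (koszul a b x) = koszul a b (\<alpha> x)"
  by (simp add: koszul_def)

lemma T_simps [simp]:
  "\<alpha> (scl T c x) = scl E c (\<alpha> x)" "x \<in> grade T a \<longleftrightarrow> \<alpha> x \<in> grade E a"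
  "\<alpha> (brkt T x y) = brkt E (\<alpha> x) (\<alpha> y)" "\<alpha> (pmap T x) = pmap E (\<alpha> x)"
  by (simp_all add: T_def)

lemma brkt_0 [simp]: "brkt E x 0 = 0"
proof -
  interpret Vector_Spaces.linear "scl E" "scl E" "\<lambda>y. brkt E x y" by (rule E.brkt_linear_right)
  show ?thesis by (rule zero)
qed

lemma coeff_ad_pencil:
  fixes L :: "('a, 'b::ab_group_add, 'c) lie_super_scheme"
  assumes "brkt L x 0 = 0" "brkt L y 0 = 0"
  shows "Polynomial.coeff (ad_pencil L x y q) n =
    (case n of 0 \<Rightarrow> 0 | Suc m \<Rightarrow> brkt L x (Polynomial.coeff q m)) + brkt L y (Polynomial.coeff q n)"
  using assms by (simp add: ad_pencil_def coeff_pCons coeff_map_poly split: nat.splits)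

lemma brkt_T_0 [simp]: "brkt T x 0 = 0"
  by (simp add: eq_iff)

lemma ad_pencil_T:
  "\<alpha> (Polynomial.coeff ((ad_pencil T x y ^^ n) [:x:]) i) =
    Polynomial.coeff ((ad_pencil E (\<alpha> x) (\<alpha> y) ^^ n) [:\<alpha> x:]) i"
proof (induction n arbitrary: i)
  case 0
  show ?case by (simp add: coeff_pCons split: nat.splits)
next
  case (Suc n)
  then show ?case by (simp add: coeff_ad_pencil add split: nat.splits)
qed

lemma jacobson_T [simp]: "\<alpha> (jacobson_s T i x y) = jacobson_s E i (\<alpha> x) (\<alpha> y)"
  by (simp add: jacobson_s_def ad_pencil_T)

lemma funpow_T [simp]: "\<alpha> ((brkt T x ^^ n) y) = (brkt E (\<alpha> x) ^^ n) (\<alpha> y)"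
  by (induction n) simp_all

lemma vector_space_T: "vector_space (scl T)"
proof -
  interpret vector_space "scl E" by (rule E.vector_space)
  show ?thesis
    by unfold_locales (simp_all add: eq_iff add scale_right_distrib scale_left_distrib)
qed

lemma linear_T:
  assumes "Vector_Spaces.linear (scl E) (scl E) f" "\<And>x. \<alpha> (f' x) = f (\<alpha> x)"
  shows "Vector_Spaces.linear (scl T) (scl T) f'"
proof -
  interpret f: Vector_Spaces.linear "scl E" "scl E" f by fact
  interpret V: vector_space "scl T" by (rule vector_space_T)
  show ?thesis
    by unfold_locales (simp_all add: eq_iff add assms(2) f.add f.scale)
qed

lemma restricted_T: "restricted_lie_superalgebra T"
proof -
  interpret VE: vector_space "scl E" by (rule E.vector_space)
  interpret VT: vector_space "scl T" by (rule vector_space_T)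
  show ?thesis
  proof (intro restricted_lie_superalgebra.intro restricted_lie_superalgebra_axioms.intro
      lie_superalgebra.intro lie_superalgebra_axioms.intro super_vector_space.intro, goal_cases)
    case 1
    show ?case by (rule vector_space_T)
  next
    case (2 a)
    show ?case
      using E.grade_subspace[of a] by (auto simp: VE.subspace_def VT.subspace_def add)
  next
    case 3
    show ?case using E.grade_disjoint by (auto simp: eq_iff set_eq_iff)
  next
    case (4 v)
    obtain v0 v1 where "v0 \<in> grade E 0" "v1 \<in> grade E 1" "\<alpha> v = v0 + v1"
      using E.grade_sum by blast
    then show ?case
      by (intro bexI[of _ "\<beta> v0"] bexI[of _ "\<beta> v1"]) (simp_all add: eq_iff add)
  next
    case (5 x)
    show ?case by (rule linear_T[OF E.brkt_linear_right]) simp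
  next
    case (6 y)
    show ?case by (rule linear_T[OF E.brkt_linear_left]) simp
  next
    case (7 x a y b)
    then show ?case unfolding T_simps by (rule E.brkt_grade)
  next
    case (8 x a y b)
    then show ?case by (simp add: eq_iff) (rule E.skew)
  next
    case (9 x a y b z c)
    then show ?case by (simp add: eq_iff add) (rule E.jacobi)
  qed (simp_all add: eq_iff add E.cubic E.pmap_even E.pmap_scl E.brkt_pmap E.pmap_add)
qed

end

lemma H2_0I:
  fixes G :: "('k::field, 'g::ab_group_add, 'x) restricted_lie_super_scheme"
    and M :: "('k, 'm::ab_group_add, 'y) restricted_lie_super_scheme"
    and E :: "('k, 'e::ab_group_add, 'z) restricted_lie_super_scheme"
  assumes g: "g \<in> carrier (Z2 G M act)"
    and E: "restricted_extension G M act E i \<phi>"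
    and eq: "equivalent_extensions (cocycle_ext G M act g) (\<lambda>m. (0, m)) fst E i \<phi>"
  shows "H2_class G M act g \<in> H2_0 G M act"
proof -
  let ?C = "cocycle_ext G M act g"
  obtain \<alpha> where bij: "bij \<alpha>" and hom: "lie_super_hom ?C E \<alpha>"
    and i: "\<And>m. i m = \<alpha> (0, m)" and \<phi>: "\<And>e. \<phi> (\<alpha> e) = fst e"
    using eq by (auto simp: equivalent_extensions_def fun_eq_iff)
  interpret \<alpha>: Vector_Spaces.linear "scl ?C" "scl E" \<alpha>
    using hom by (simp add: lie_super_hom_def even_linear_def)
  interpret E: restricted_lie_superalgebra E
    using E by (simp add: restricted_extension_def)
  obtain \<beta> where "\<And>y. \<alpha> (\<beta> y) = y" "\<And>x. \<beta> (\<alpha> x) = x"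
    using bij by (metis bij_pointE)
  then interpret transport E \<alpha> \<beta>
    by unfold_locales (simp_all add: \<alpha>.add)
  have ext: "extension G M act E i \<phi>" using E by (simp add: restricted_extension_def)
  have lin_i: "Vector_Spaces.linear (scl M) (scl E) i"
    and lin_\<phi>: "Vector_Spaces.linear (scl E) (scl G) \<phi>"
    using ext by (simp_all add: extension_def lie_super_hom_def even_linear_def)
  interpret i: Vector_Spaces.linear "scl M" "scl E" i by fact
  interpret \<phi>: Vector_Spaces.linear "scl E" "scl G" \<phi> by fact
  interpret VT: vector_space "scl T" by (rule vector_space_T)
  have hom_i: "lie_super_hom M T (\<lambda>m. (0, m))"
    unfolding lie_super_hom_def even_linear_def
  proof (intro conjI allI)
    show "Vector_Spaces.linear (scl M) (scl T) (\<lambda>m. (0, m))"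
      by unfold_locales (simp_all add: eq_iff add i[symmetric] i.add i.scale)
  qed (use ext in \<open>auto simp: extension_def lie_super_hom_def even_linear_def eq_iff
        i[symmetric] image_subset_iff\<close>)
  have fst_T: "fst x = \<phi> (\<alpha> x)" for x by (simp add: \<phi>)
  have hom_\<phi>: "lie_super_hom T G fst"
    unfolding lie_super_hom_def even_linear_def
  proof (intro conjI allI)
    show "Vector_Spaces.linear (scl T) (scl G) fst"
      by unfold_locales (simp_all add: fst_T add \<phi>.add \<phi>.scale del: \<phi>)
  qed (use ext in \<open>auto simp: extension_def lie_super_hom_def even_linear_def fst_T
        image_subset_iff\<close>)
  have "extension G M act T (\<lambda>m. (0, m)) fst"
    using hom_i hom_\<phi> ext restricted_T
    by (auto simp: extension_def restricted_lie_superalgebra_def inj_on_def eq_iff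
        i[symmetric] \<phi>)
  then have "restricted_extension G M act T (\<lambda>m. (0, m)) fst"
    using E restricted_T
    by (auto simp: restricted_extension_def eq_iff i[symmetric] fst_T simp del: \<phi>)
  moreover have "equivalent_extensions ?C (\<lambda>m. (0, m)) fst T (\<lambda>m. (0, m)) fst"
    unfolding equivalent_extensions_def
  proof (intro exI[of _ id] conjI)
    have "Vector_Spaces.linear (scl ?C) (scl T) id"
      by unfold_locales (simp_all add: eq_iff \<alpha>.scale)
    then show "lie_super_hom ?C T id"
      using hom by (auto simp: lie_super_hom_def even_linear_def eq_iff image_subset_iff)
  qed simp_all
  ultimately show ?thesis
    using g unfolding H2_0_def by blast
qed


section \<open>The map $\Phi$\<close>

definition semilinear_H1 ::
  "('k::field, 'g::ab_group_add, 'y) lie_super_scheme \<Rightarrow>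
   ('k, 'm::ab_group_add, 'z) super_space_scheme \<Rightarrow> ('g \<Rightarrow> 'm \<Rightarrow> 'm) \<Rightarrow>
   ('g \<Rightarrow> ('g \<Rightarrow> 'm) set) monoid" where
  "semilinear_H1 G M act =
     \<lparr>carrier = {F \<in> grade G 0 \<rightarrow>\<^sub>E carrier (H1 G M act).
        \<forall>c. \<forall>x\<in>grade G 0. \<forall>y\<in>grade G 0.
          F (scl G c x + y) = H1_scl G M act (c ^ CHAR('k)) (F x) \<otimes>\<^bsub>H1 G M act\<^esub> F y},
      monoid.mult = (\<lambda>F F'. \<lambda>x\<in>grade G 0. F x \<otimes>\<^bsub>H1 G M act\<^esub> F' x),
      monoid.one = (\<lambda>x\<in>grade G 0. \<one>\<^bsub>H1 G M act\<^esub>)\<rparr>"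

definition Phi_cochain ::
  "('k::field, 'g::ab_group_add, 'y) restricted_lie_super_scheme \<Rightarrow>
   (('k, 'g) free_alg set \<Rightarrow> ('k, 'g) free_alg set \<Rightarrow> 'm::ab_group_add) \<Rightarrow> 'g \<Rightarrow> 'g \<Rightarrow> 'm" where
  "Phi_cochain G g x =
     (let z = env_in G x [^]\<^bsub>Env G\<^esub> CHAR('k) \<ominus>\<^bsub>Env G\<^esub> env_in G (pmap G x)
      in (\<lambda>x1. g z (env_in G x1) - g (env_in G x1) z))"

text \<open>
  The class in \<open>H1\<close> does not depend on the representative \<open>g \<in> C\<close>, so the union is that class.
\<close>

definition Phi ::
  "('k::field, 'g::ab_group_add, 'y) restricted_lie_super_scheme \<Rightarrow>
   ('k, 'm::ab_group_add, 'z) super_space_scheme \<Rightarrow> ('g \<Rightarrow> 'm \<Rightarrow> 'm) \<Rightarrow>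
   (('k, 'g) free_alg set \<Rightarrow> ('k, 'g) free_alg set \<Rightarrow> 'm) set \<Rightarrow> 'g \<Rightarrow> ('g \<Rightarrow> 'm) set" where
  "Phi G M act C =
     (\<lambda>x\<in>grade G 0. \<Union>g\<in>C. H1_class G M act (Phi_cochain G g x))"

end

theory Submission
  imports Defs "HOL-Computational_Algebra.Formal_Power_Series"
begin

text \<open>
  A 2-cocycle $g$ turns $A = U(\mathfrak g)^+ \oplus M$ into an associative algebra with product
  $(s,m)(t,n) = (st, s \cdot n + g(s,t))$, and $(x,m) \mapsto (x,m)$ is a homomorphism from $E_g$ to
  $A$ with the supercommutator that is the identity on the $M$-components. For even $u = (x,m)$ the
  $p$-th power in $A$ is $u^p = (x^p, P(u))$, and $\mathrm{ad}(u)^p = \mathrm{ad}(u^p)$. With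
  $z = x^p - x^{[p]}$, which is central in $U(\mathfrak g)$ and annihilates $M$, an element
  $(x^{[p]}, P(u) - c)$ of $E_g$ acts on $E_g$ as $\mathrm{ad}(u)^p$ if and only if
  $g(z,y) - g(y,z) = y \cdot c$ for all $y$, that is, if and only if $c$ is a primitive of $\Phi(g)(x)$.
  So a restricted structure provides primitives. Conversely, as $z$ is $p$-semilinear in $x$,
  primitives chosen on a basis of $\mathfrak g_{\bar 0}$ extend to a $p$-semilinear choice $c_x$, and
  then $u \mapsto (x^{[p]}, P(u) - c_x)$ is a $p$-map on $E_g$ by Jacobson's formula in $A$.
\<close>

section \<open>Jacobson's formula\<close>

text \<open>Two obstacles shape the proof. Elements of U(G) are cosets, and A is not a ring type,
  whereas Jacobson's formula is an identity in a ring. So an element of A is replaced by an operator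
  that induces left multiplication on A with a unit adjoined, and elements of U(G) by
  representatives in the free algebra. The unit makes this faithful: the value at 1 recovers the
  element. Secondly, an operator sees the \<open>G\<close>-component of an element of E_g only
  through its image in U(G). Every identity in E_g is therefore split: the
  \<open>G\<close>-component follows from the axioms of \<open>G\<close>, the
  \<open>M\<close>-component from the operators. That E_g is a Lie superalgebra is itself proved in
  this way. The choice of primitives on a basis is free because the nonlinear part of a p-map is
  already settled: the corrections s_i in x^p and in x^{[p]} are the same, so they cancel in
  z.\<close>

abbreviation ring_ad :: "'a::ring_1 \<Rightarrow> 'a \<Rightarrow> 'a" where
  "ring_ad t z \<equiv> t * z - z * t"

lemma of_nat_left_commute:
  fixes t z :: "'a::semiring_1"
  shows "t * (of_nat n * z) = of_nat n * (t * z)"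
  by (metis mult.assoc mult_of_nat_commute)

text \<open>Left multiplication by t is the sum of ad t and right multiplication by t. These two
  operators commute, so this is the binomial theorem; the induction is Pascal's rule.\<close>

lemma power_mult_eq_sum_ad:
  fixes t x :: "'a::ring_1"
  shows "t ^ n * x = (\<Sum>i\<le>n. of_nat (n choose i) * ((ring_ad t ^^ i) x * t ^ (n - i)))"
proof (induction n)
  case (Suc n)
  define D where "D i = (ring_ad t ^^ i) x" for i
  have D: "t * (D i * z) = D (Suc i) * z + D i * (t * z)" for i z
    by (simp add: D_def algebra_simps)
  have "t ^ Suc n * x = (\<Sum>i\<le>n. of_nat (n choose i) * (t * (D i * t ^ (n - i))))"
    unfolding power_Suc mult.assoc Suc.IH sum_distrib_left D_def
    by (simp only: of_nat_left_commute)
  also have "\<dots> = (\<Sum>i\<le>n. of_nat (n choose i) * (D (Suc i) * t ^ (n - i)) +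
      of_nat (n choose i) * (D i * t ^ (Suc n - i)))"
    by (intro sum.cong refl) (simp add: D distrib_left Suc_diff_le)
  also have "\<dots> = (\<Sum>i\<le>n. of_nat (n choose i) * (D (Suc i) * t ^ (n - i))) +
      (\<Sum>i\<le>Suc n. of_nat (n choose i) * (D i * t ^ (Suc n - i)))"
    by (simp add: sum.distrib binomial_eq_0)
  also have "\<dots> = (\<Sum>i\<le>Suc n. of_nat (Suc n choose i) * (D i * t ^ (Suc n - i)))"
    by (simp add: sum.distrib sum.atMost_Suc_shift[of _ n] distrib_right add_ac
        del: sum.atMost_Suc)
  finally show ?case by (simp add: D_def)
qed simp

text \<open>In characteristic p the inner binomial coefficients of
  \<open>power_mult_eq_sum_ad\<close> vanish, and only the terms i = 0 and i = p remain.\<close>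

lemma ad_power_char:
  fixes t x :: "'a::ring_1"
  assumes p: "prime p" and char: "of_nat p = (0::'a)"
  shows "(ring_ad t ^^ p) x = ring_ad (t ^ p) x"
proof -
  have "of_nat (p choose i) = (0::'a)" if "i \<in> {..p} - {0, p}" for i
  proof -
    from that have "p dvd (p choose i)" using p by (intro dvd_choose_prime) auto
    then show ?thesis using char by (auto elim!: dvdE)
  qed
  then have "t ^ p * x = (\<Sum>i\<in>{0, p}. of_nat (p choose i) * ((ring_ad t ^^ i) x * t ^ (p - i)))"
    unfolding power_mult_eq_sum_ad by (intro sum.mono_neutral_right) auto
  also have "\<dots> = x * t ^ p + (ring_ad t ^^ p) x" using p by (auto simp: prime_gt_0_nat)
  finally show ?thesis by simp
qed

text \<open>The product rule gives the sum of t^j t' t^(n-1-j) over j < n. Expanding each t^j t' by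
  \<open>power_mult_eq_sum_ad\<close> and summing the binomials (j choose i) over j gives (n choose
  i+1).\<close>

lemma fps_deriv_power_eq_sum_ad:
  fixes t :: "'a::ring_1 fps"
  shows "fps_deriv (t ^ n) =
    (\<Sum>i<n. of_nat (n choose Suc i) * ((ring_ad t ^^ i) (fps_deriv t) * t ^ (n - Suc i)))"
proof (induction n)
  case (Suc n)
  define D where "D i = (ring_ad t ^^ i) (fps_deriv t)" for i
  have D: "t * (D i * z) = D (Suc i) * z + D i * (t * z)" for i z
    by (simp add: D_def algebra_simps)
  have "fps_deriv (t ^ Suc n) = fps_deriv t * t ^ n +
      (\<Sum>i<n. of_nat (n choose Suc i) * (t * (D i * t ^ (n - Suc i))))"
    unfolding power_Suc fps_deriv_mult Suc.IH sum_distrib_left D_def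
    by (simp only: of_nat_left_commute add.commute)
  also have "\<dots> = D 0 * t ^ n +
     (\<Sum>i<n. of_nat (n choose Suc i) * (D (Suc i) * t ^ (n - Suc i)) +
      of_nat (n choose Suc i) * (D i * t ^ (n - i)))"
  proof -
    have *: "t ^ (n - i) = t * t ^ (n - Suc i)" if "i < n" for i
      using that by (simp flip: power_Suc add: Suc_diff_Suc)
    show ?thesis
      by (intro arg_cong2[of _ _ _ _ "(+)"] sum.cong refl)
        (simp_all add: D distrib_left *, simp add: D_def)
  qed
  \<comment> \<open>The added term i = n has coefficient (n choose n+1) = 0; with equal ranges the
    two sums combine by Pascal's rule.\<close>
  also have "(\<Sum>i<n. of_nat (n choose Suc i) * (D i * t ^ (n - i))) =
      (\<Sum>i<Suc n. of_nat (n choose Suc i) * (D i * t ^ (n - i)))" by (simp add: binomial_eq_0)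
  then have "D 0 * t ^ n +
     (\<Sum>i<n. of_nat (n choose Suc i) * (D (Suc i) * t ^ (n - Suc i)) +
      of_nat (n choose Suc i) * (D i * t ^ (n - i))) =
     (\<Sum>i<Suc n. of_nat (n choose i) * (D i * t ^ (n - i))) +
     (\<Sum>i<Suc n. of_nat (n choose Suc i) * (D i * t ^ (n - i)))"
    unfolding sum.distrib by (simp add: sum.lessThan_Suc_shift[of _ n] del: sum.lessThan_Suc)
  also have "\<dots> = (\<Sum>i<Suc n. of_nat (Suc n choose Suc i) * (D i * t ^ (Suc n - Suc i)))"
    by (simp add: binomial_Suc_Suc distrib_right sum.distrib del: sum.lessThan_Suc)
  finally show ?case by (simp add: D_def)
qed simp

text \<open>The element lambda x + y, with \<open>fps_X\<close> as the central variable lambda;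
  power series allow the coefficients x and y not to commute.\<close>

definition pencil :: "'a::ring_1 \<Rightarrow> 'a \<Rightarrow> 'a fps" where
  "pencil x y = fps_const x * fps_X + fps_const y"

lemma pencil_mult_nth:
  "(pencil x y * f) $ n = (case n of 0 \<Rightarrow> 0 | Suc m \<Rightarrow> x * f $ m) + y * f $ n"
  by (simp add: pencil_def distrib_right mult.assoc split: nat.splits)

lemma mult_pencil_nth:
  "(f * pencil x y) $ n = (case n of 0 \<Rightarrow> 0 | Suc m \<Rightarrow> f $ m * x) + f $ n * y"
proof -
  have "f * pencil x y = f * fps_const x * fps_X + f * fps_const y"
    by (simp add: pencil_def distrib_left mult.assoc)
  then show ?thesis by (simp split: nat.splits)
qed

lemma
  shows pencil_power_nth_gt: "n < i \<Longrightarrow> (pencil x y ^ n) $ i = 0"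
    and pencil_power_nth_self: "(pencil x y ^ n) $ n = x ^ n"
    and pencil_power_nth_0: "(pencil x y ^ n) $ 0 = y ^ n"
  by (induction n arbitrary: i) (auto simp: pencil_mult_nth split: nat.splits simp del: fps_mult_nth_0)

text \<open>This is evaluation at lambda = 1, written as a finite sum because the n-th power of the
  pencil has degree at most n.\<close>

lemma sum_pencil_power_nth: "(\<Sum>i\<le>n. (pencil x y ^ n) $ i) = (x + y) ^ n"
proof (induction n)
  case (Suc n)
  have "(\<Sum>i\<le>Suc n. (pencil x y ^ Suc n) $ i) =
      (\<Sum>i\<le>n. x * (pencil x y ^ n) $ i) + (\<Sum>i\<le>Suc n. y * (pencil x y ^ n) $ i)"
    unfolding power_Suc pencil_mult_nth sum.distrib
    by (simp add: sum.atMost_Suc_shift[of _ n] del: sum.atMost_Suc)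
  also have "\<dots> = (x + y) * (\<Sum>i\<le>n. (pencil x y ^ n) $ i)"
    by (simp add: pencil_power_nth_gt distrib_right sum_distrib_left sum.distrib)
  finally show ?case by (simp add: Suc.IH)
qed simp

text \<open>Setting lambda = 1 in the p-th power of the pencil gives (x + y)^p; its extreme
  coefficients are y^p and x^p. Differentiating in lambda turns the i-th coefficient into i times
  itself and the power into ad^(p-1) applied to x.\<close>

lemma jacobson_formula:
  fixes x y :: "'a::ring_1"
  assumes p: "prime p" and char: "of_nat p = (0::'a)"
  shows "(x + y) ^ p = x ^ p + y ^ p + (\<Sum>i=1..p-1. (pencil x y ^ p) $ i)"
    and "1 \<le> i \<Longrightarrow>
      of_nat i * (pencil x y ^ p) $ i = ((ring_ad (pencil x y) ^^ (p - 1)) (fps_const x)) $ (i - 1)"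
proof -
  have p1: "p > 1" using p by (rule prime_gt_1_nat)
  then have "{..p} = insert 0 (insert p {1..p-1})" by auto
  then show "(x + y) ^ p = x ^ p + y ^ p + (\<Sum>i=1..p-1. (pencil x y ^ p) $ i)"
    using p1 by (simp add: sum_pencil_power_nth[symmetric] pencil_power_nth_0 pencil_power_nth_self)
  have deriv: "fps_deriv (pencil x y) = fps_const x"
    by (rule fps_ext) (simp add: pencil_def)
  have "of_nat (p choose Suc i) = (0::'a fps)" if "i \<in> {..<p} - {p - 1}" for i
  proof -
    from that have "p dvd (p choose Suc i)" using p by (intro dvd_choose_prime) auto
    then obtain k where "p choose Suc i = p * k" ..
    then show ?thesis using char by (simp flip: fps_of_nat)
  qed
  \<comment> \<open>Only i = p - 1 survives: there the binomial coefficient is 1 and the remaining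
    power of the pencil is the zeroth.\<close>
  then have "fps_deriv (pencil x y ^ p) = (\<Sum>i\<in>{p - 1}. of_nat (p choose Suc i) *
      ((ring_ad (pencil x y) ^^ i) (fps_const x) * pencil x y ^ (p - Suc i)))"
    unfolding fps_deriv_power_eq_sum_ad deriv using p1 by (intro sum.mono_neutral_right) auto
  also have "\<dots> = (ring_ad (pencil x y) ^^ (p - 1)) (fps_const x)" using p1 by simp
  finally have "fps_deriv (pencil x y ^ p) = (ring_ad (pencil x y) ^^ (p - 1)) (fps_const x)" .
  from arg_cong[OF this, of "\<lambda>f. f $ (i - 1)"]
  show "1 \<le> i \<Longrightarrow>
      of_nat i * (pencil x y ^ p) $ i = ((ring_ad (pencil x y) ^^ (p - 1)) (fps_const x)) $ (i - 1)"
    by simp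
qed

section \<open>The ring of additive operators on a product\<close>

text \<open>A ring type to which the formulas of the previous section apply. The first factor is a
  \<open>ring_1\<close> so that the product is nonzero and the operators satisfy 0 \<noteq>
  1.\<close>

typedef (overloaded) ('a, 'b) prod_endo =
  "{f :: 'a::ring_1 \<times> 'b::ab_group_add \<Rightarrow> 'a \<times> 'b. \<forall>u v. f (u + v) = f u + f v}"
  morphisms app Prod_endo
  by (rule exI[of _ id]) simp

lemma app_add: "app T (u + v) = app T u + app T v"
  using app[of T] by blast

lemma app_0 [simp]: "app T 0 = 0"
  using app_add[of T 0 0] by simp

lemma app_Prod_endo: "(\<And>u v. f (u + v) = f u + f v) \<Longrightarrow> app (Prod_endo f) = f"
  by (rule Prod_endo_inverse) blast

lemma prod_endo_eqI: "(\<And>v. app S v = app T v) \<Longrightarrow> S = T"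
  by (simp add: app_inject[symmetric] fun_eq_iff)

instantiation prod_endo :: (ring_1, ab_group_add) ring_1
begin

definition "0 = Prod_endo (\<lambda>v. 0)"
definition "1 = Prod_endo (\<lambda>v. v)"
definition "S + T = Prod_endo (\<lambda>v. app S v + app T v)"
definition "S - T = Prod_endo (\<lambda>v. app S v - app T v)"
definition "- T = Prod_endo (\<lambda>v. - app T v)"
definition "S * T = Prod_endo (\<lambda>v. app S (app T v))"

lemma app_simps [simp]:
  fixes S T :: "('a, 'b) prod_endo"
  shows "app (0 :: ('a, 'b) prod_endo) v = 0" "app (1 :: ('a, 'b) prod_endo) v = v"
    "app (S + T) v = app S v + app T v" "app (S - T) v = app S v - app T v"
    "app (- T) v = - app T v" "app (S * T) v = app S (app T v)"
  unfolding zero_prod_endo_def one_prod_endo_def plus_prod_endo_def minus_prod_endo_def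
    uminus_prod_endo_def times_prod_endo_def
  by (subst app_Prod_endo; simp add: app_add)+

instance
proof
  have "app (0 :: ('a, 'b) prod_endo) (1, 0) \<noteq> app 1 (1, 0)" by (simp add: zero_prod_def)
  then show "(0 :: ('a, 'b) prod_endo) \<noteq> 1" by metis
qed (rule prod_endo_eqI, simp add: app_add)+

end

lemma app_of_nat: "app (of_nat n) v = ((+) v ^^ n) 0"
  by (induction n) simp_all

section \<open>Representatives in the free algebra\<close>

lemma free_alg_induct [case_names zero single add]:
  fixes f :: "'a \<Rightarrow>\<^sub>0 'b::comm_monoid_add"
  assumes zero: "P 0" and single: "\<And>w c. P (Poly_Mapping.single w c)"
    and add: "\<And>f h. P f \<Longrightarrow> P h \<Longrightarrow> P (f + h)"
  shows "P f"
proof (induction f rule: update_induct)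
  case const
  show ?case by (rule zero)
next
  case (update f w c)
  have "Poly_Mapping.update w c f = f + Poly_Mapping.single w c"
    using update(1) by (intro poly_mapping_eqI)
      (auto simp: lookup_update lookup_add lookup_single when_def in_keys_iff)
  then show ?case by (simp add: add single update.IH)
qed

lemma ring_free_ring: "ring (free_ring :: ('k::field, 'g) free_alg ring)"
proof -
  have "\<exists>y. x + y = 0" for x :: "('k, 'g) free_alg"
    using add.right_inverse by blast
  then show ?thesis
    unfolding free_ring_def ring_of_type_algebra_def using add.right_inverse
    by unfold_locales (auto simp: algebra_simps Units_def)
qed

lemma free_ring_simps [simp]:
  "carrier free_ring = UNIV" "f \<otimes>\<^bsub>free_ring\<^esub> h = f * h" "f \<oplus>\<^bsub>free_ring\<^esub> h = f + h"
  "\<zero>\<^bsub>free_ring\<^esub> = 0" "\<one>\<^bsub>free_ring\<^esub> = 1"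
  by (simp_all add: free_ring_def ring_of_type_algebra_def)

lemma free_ring_minus [simp]: "\<ominus>\<^bsub>free_ring\<^esub> f = - f"
proof -
  interpret ring free_ring by (rule ring_free_ring)
  show ?thesis using minus_equality[of "- f" f] by simp
qed

lemma ideal_env_ideal: "ideal (env_ideal G) free_ring"
  unfolding env_ideal_def by (rule ring.genideal_ideal[OF ring_free_ring]) simp

lemma env_relations_subset: "env_relations G \<subseteq> env_ideal G"
  unfolding env_ideal_def by (rule ring.genideal_self[OF ring_free_ring]) simp

lemma env_class_eq_iff: "env_class G f = env_class G h \<longleftrightarrow> f - h \<in> env_ideal G"
proof -
  interpret ideal "env_ideal G" free_ring by (rule ideal_env_ideal)
  interpret abelian_subgroup "env_ideal G" free_ring
    by (rule abelian_subgroupI3) (unfold_locales)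
  show ?thesis
    unfolding env_class_def
    using a_repr_independence'[of f h] a_rcos_self[of f] a_rcos_module_minus[of h f]
      ring_free_ring
    by (auto simp: a_minus_def)
qed

lemma ring_Env: "ring (Env G)"
  unfolding Env_def by (rule ideal.quotient_is_ring[OF ideal_env_ideal])

lemma carrier_Env: "carrier (Env G) = range (env_class G)"
  unfolding Env_def FactRing_def A_RCOSETS_def' env_class_def[abs_def] by auto

lemma env_class_hom: "env_class G \<in> ring_hom free_ring (Env G)"
  using ideal.rcos_ring_hom[OF ideal_env_ideal, of G] by (simp add: env_class_def[abs_def] Env_def)

lemma env_class_add: "env_class G (f + h) = env_class G f \<oplus>\<^bsub>Env G\<^esub> env_class G h"
  using ring_hom_add[OF env_class_hom, of f h G] by simp

lemma env_class_mult: "env_class G (f * h) = env_class G f \<otimes>\<^bsub>Env G\<^esub> env_class G h"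
  using ring_hom_mult[OF env_class_hom, of f h G] by simp

lemma env_class_one: "env_class G 1 = \<one>\<^bsub>Env G\<^esub>"
  using ring_hom_one[OF env_class_hom, of G] by simp

lemma env_class_diff: "env_class G (f - h) = env_class G f \<ominus>\<^bsub>Env G\<^esub> env_class G h"
proof -
  interpret ring_hom_ring free_ring "Env G" "env_class G"
    by (intro ring_hom_ringI2 ring_free_ring ring_Env env_class_hom)
  have "env_class G (- h) = \<ominus>\<^bsub>Env G\<^esub> env_class G h"
    using hom_a_inv[of h] by simp
  then show ?thesis
    unfolding diff_conv_add_uminus env_class_add by (simp add: a_minus_def)
qed

lemma env_class_pow: "env_class G (f ^ n) = env_class G f [^]\<^bsub>Env G\<^esub> (n::nat)"
proof -
  interpret ring "Env G" by (rule ring_Env)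
  show ?thesis by (induction n) (simp_all add: env_class_one env_class_mult power_Suc2 del: power_Suc)
qed

lemma env_scl_class: "env_scl G c (env_class G f) = env_class G (free_scl c f)"
  by (simp add: env_scl_def free_scl_def env_class_mult)

lemma env_class_cong:
  assumes "env_class G f = env_class G f'" "env_class G h = env_class G h'"
  shows "env_class G (f + h) = env_class G (f' + h')" "env_class G (f - h) = env_class G (f' - h')"
    "env_class G (f * h) = env_class G (f' * h')"
    "env_class G (free_scl c f) = env_class G (free_scl c f')"
  using assms by (simp_all add: env_class_add env_class_diff env_class_mult env_scl_class[symmetric])

lemma env_class_var_add: "env_class G (free_var (x + y)) = env_class G (free_var x + free_var y)"
proof -
  have "free_var (x + y) - free_var x - free_var y \<in> env_relations G"
    unfolding env_relations_def by blast
  then show ?thesis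
    using env_relations_subset[of G] by (auto simp: env_class_eq_iff diff_diff_eq)
qed

lemma env_class_var_scl: "env_class G (free_var (scl G c x)) = env_class G (free_scl c (free_var x))"
proof -
  have "free_var (scl G c x) - free_scl c (free_var x) \<in> env_relations G"
    unfolding env_relations_def by blast
  then show ?thesis
    using env_relations_subset[of G] by (auto simp: env_class_eq_iff)
qed

lemma env_class_var_brkt:
  assumes "x \<in> grade G a" "y \<in> grade G b"
  shows "env_class G (free_var (brkt G x y)) =
    env_class G (free_var x * free_var y - koszul a b (free_var y * free_var x))"
proof -
  have "free_var (brkt G x y) - (free_var x * free_var y - koszul a b (free_var y * free_var x))
      \<in> env_relations G"
    unfolding env_relations_def using assms by blast
  then show ?thesis
    using env_relations_subset[of G] by (auto simp: env_class_eq_iff)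
qed

lemma env_class_var_0: "env_class G (free_var 0) = env_class G 0"
proof -
  have "env_class G (free_var 0 - (free_var 0 + free_var 0)) = env_class G 0"
    using env_class_var_add[of G 0 0] by (simp add: env_class_eq_iff)
  then have "env_class G (0 - (- free_var 0)) = env_class G (0 - 0)"
    by (intro env_class_cong) simp_all
  then show ?thesis by simp
qed

section \<open>The preimage of U(G)^+ in the free algebra\<close>

definition free_plus ::
  "('k::field, 'g::ab_group_add, 'z) lie_super_scheme \<Rightarrow> ('k, 'g) free_alg set" where
  "free_plus G = {f. env_class G f \<in> Env_plus G}"

lemma ideal_Env_plus: "ideal (Env_plus G) (Env G)"
  unfolding Env_plus_def
  by (rule ring.genideal_ideal[OF ring_Env]) (auto simp: carrier_Env env_in_def)

lemma free_plus_var [simp]: "free_var x \<in> free_plus G"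
proof -
  have "range (env_in G) \<subseteq> Env_plus G" unfolding Env_plus_def
    by (rule ring.genideal_self[OF ring_Env]) (auto simp: carrier_Env env_in_def)
  then show ?thesis by (auto simp: free_plus_def env_in_def)
qed

lemma
  assumes "f \<in> free_plus G"
  shows free_plus_add: "h \<in> free_plus G \<Longrightarrow> f + h \<in> free_plus G"
    and free_plus_diff: "h \<in> free_plus G \<Longrightarrow> f - h \<in> free_plus G"
    and free_plus_mult_left: "h * f \<in> free_plus G"
    and free_plus_mult_right: "f * h \<in> free_plus G"
    and free_plus_scl: "free_scl c f \<in> free_plus G"
proof -
  interpret ideal "Env_plus G" "Env G" by (rule ideal_Env_plus)
  show "h \<in> free_plus G \<Longrightarrow> f + h \<in> free_plus G"
    using assms by (simp add: free_plus_def env_class_add a_closed)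
  show "h \<in> free_plus G \<Longrightarrow> f - h \<in> free_plus G"
    using assms by (simp add: free_plus_def env_class_diff a_minus_def a_closed a_inv_closed)
  show "h * f \<in> free_plus G" for h
    using assms by (simp add: free_plus_def env_class_mult I_l_closed carrier_Env)
  then show "free_scl c f \<in> free_plus G" by (simp add: free_scl_def)
  show "f * h \<in> free_plus G"
    using assms by (simp add: free_plus_def env_class_mult I_r_closed carrier_Env)
qed

lemma free_plus_0 [simp]: "0 \<in> free_plus G"
  using free_plus_mult_left[OF free_plus_var, of 0] by simp

lemma free_plus_power: "0 < n \<Longrightarrow> free_var x ^ n \<in> free_plus G"
  by (cases n) (auto intro: free_plus_mult_right)

lemma Env_plusE:
  assumes "s \<in> Env_plus G"
  obtains f where "f \<in> free_plus G" "s = env_class G f"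
proof -
  interpret ideal "Env_plus G" "Env G" by (rule ideal_Env_plus)
  show ?thesis using assms that a_Hcarr[OF assms] by (auto simp: carrier_Env free_plus_def)
qed

section \<open>The augmentation of the free algebra and its complement\<close>

definition augment :: "('k::field, 'g) free_alg \<Rightarrow> 'k" where
  "augment f = Poly_Mapping.lookup f 0"

definition plus_part :: "('k::field, 'g) free_alg \<Rightarrow> ('k, 'g) free_alg" where
  "plus_part f = f - Poly_Mapping.single 0 (augment f)"

lemma augment_add: "augment (f + h) = augment f + augment h"
  by (simp add: augment_def lookup_add)

lemma augment_diff: "augment (f - h) = augment f - augment h"
  by (simp add: augment_def lookup_minus)

lemma augment_one [simp]: "augment 1 = 1"
  by (simp add: augment_def)

lemma plus_part_add: "plus_part (f + h) = plus_part f + plus_part h"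
  by (simp add: plus_part_def augment_add single_add)

text \<open>A nonempty word starts with a letter, so its monomial is a right multiple of a generator
  of the ideal.\<close>

lemma plus_part_in_free_plus: "plus_part f \<in> free_plus G"
proof (induction f rule: free_alg_induct)
  case zero
  show ?case by (simp add: plus_part_def augment_def)
next
  case (single w c)
  show ?case
  proof (cases "letters w")
    case Nil
    then have "w = 0" by (cases w) (simp add: zero_word_def)
    then show ?thesis by (simp add: plus_part_def augment_def)
  next
    case (Cons x xs)
    then have "w \<noteq> 0" and "w = Word [x] + Word xs"
      by (cases w; simp add: zero_word_def plus_word_def)+
    then have "plus_part (Poly_Mapping.single w c) = free_var x * Poly_Mapping.single (Word xs) c"
      by (simp add: plus_part_def augment_def lookup_single free_var_def mult_single)
    then show ?thesis by (simp add: free_plus_mult_right)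
  qed
next
  case (add f h)
  then show ?case by (simp add: plus_part_add free_plus_add)
qed

lemma single_0_commute:
  fixes f :: "'a::monoid_add \<Rightarrow>\<^sub>0 'b::comm_semiring_1"
  shows "Poly_Mapping.single 0 c * f = f * Poly_Mapping.single 0 c"
  by (induction f rule: free_alg_induct) (simp_all add: mult_single distrib_left distrib_right mult.commute)

lemma plus_word_eq_0_iff: "u + v = 0 \<longleftrightarrow> u = 0 \<and> v = (0 :: 'a word)"
  by (cases u; cases v) (simp add: plus_word_def zero_word_def)

lemma augment_mult: "augment (f * h) = augment f * augment h"
proof (induction f rule: free_alg_induct)
  case (single w c)
  show ?case
    by (induction h rule: free_alg_induct)
      (auto simp: mult_single augment_def lookup_single when_def plus_word_eq_0_iff
        distrib_left lookup_add)
qed (auto simp: augment_def distrib_right lookup_add)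

lemma augment_var [simp]: "augment (free_var x) = 0"
  by (simp add: augment_def free_var_def lookup_single zero_word_def)

lemma plus_part_eq: "plus_part f + Poly_Mapping.single 0 (augment f) = f"
  by (simp add: plus_part_def)

lemma vector_space_free_scl: "vector_space (free_scl :: 'k::field \<Rightarrow> ('k, 'g) free_alg \<Rightarrow> _)"
  by unfold_locales
    (simp_all add: free_scl_def algebra_simps single_add mult_single mult.assoc[symmetric])

lemma free_grade_diff:
  assumes "f \<in> free_grade G a" "h \<in> free_grade G a"
  shows "f - h \<in> free_grade G a"
proof -
  interpret vector_space free_scl by (rule vector_space_free_scl)
  show ?thesis using assms unfolding free_grade_def by (rule span_diff)
qed

lemma free_var_power: "free_var x ^ n = Poly_Mapping.single (Word (replicate n x)) 1"
  by (induction n)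
    (simp_all add: free_var_def mult_single plus_word_def zero_word_def[symmetric])

lemma free_var_power_grade:
  assumes "x \<in> grade G a" "n = 1 \<or> a = 0"
  shows "free_var x ^ n \<in> free_grade G a"
proof -
  interpret vector_space free_scl by (rule vector_space_free_scl)
  have "list_all2 (\<lambda>x b. x \<in> grade G b) (replicate n x) (replicate n a)"
    using assms by (simp add: list_all2_conv_all_nth)
  moreover have "sum_list (replicate n a) = a"
    using assms(2) by (auto simp: sum_list_replicate)
  ultimately show ?thesis
    unfolding free_grade_def free_var_power by (intro span_base) blast
qed

lemma free_var_grade: "x \<in> grade G a \<Longrightarrow> free_var x \<in> free_grade G a"
  using free_var_power_grade[of x G a 1] by simp

section \<open>Super vector spaces\<close>

sublocale super_vector_space \<subseteq> VS: vector_space "scl V"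
  by (rule vector_space)

lemma bit_cases [case_names zero one]: "(a = 0 \<Longrightarrow> P) \<Longrightarrow> (a = 1 \<Longrightarrow> P) \<Longrightarrow> P" for a :: bit
  by (cases a) auto

lemma linear_additive: "Vector_Spaces.linear s t f \<Longrightarrow> f (x + y) = f x + f y"
  unfolding Vector_Spaces.linear_def by (blast dest: module_hom.add)

lemma linear_homogeneous: "Vector_Spaces.linear s t f \<Longrightarrow> f (s c x) = t c (f x)"
  unfolding Vector_Spaces.linear_def by (blast dest: module_hom.scale)

context super_vector_space
begin

lemma grade_0 [simp]: "0 \<in> grade V a"
  using grade_subspace VS.subspace_0 by blast

lemma grade_add: "x \<in> grade V a \<Longrightarrow> y \<in> grade V a \<Longrightarrow> x + y \<in> grade V a"
  using grade_subspace VS.subspace_add by blast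

lemma grade_diff: "x \<in> grade V a \<Longrightarrow> y \<in> grade V a \<Longrightarrow> x - y \<in> grade V a"
  using grade_subspace VS.subspace_diff by blast

lemma grade_minus: "x \<in> grade V a \<Longrightarrow> - x \<in> grade V a"
  using grade_diff[of 0 a x] by simp

lemma grade_scl: "x \<in> grade V a \<Longrightarrow> scl V c x \<in> grade V a"
  using grade_subspace VS.subspace_scale by blast

lemma grade_koszul: "x \<in> grade V c \<Longrightarrow> koszul a b x \<in> grade V c"
  by (simp add: koszul_def grade_minus)

lemma grade_both: "x \<in> grade V a \<Longrightarrow> x \<in> grade V (a + 1) \<Longrightarrow> x = 0"
  using grade_disjoint by (cases a) auto

lemma component_unique:
  assumes "u \<in> grade V a" "v - u \<in> grade V (a + 1)"
  shows "component V a v = u"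
  unfolding component_def
proof (rule the_equality)
  fix w assume w: "w \<in> grade V a \<and> v - w \<in> grade V (a + 1)"
  then have "w - u \<in> grade V a" using assms grade_diff by blast
  moreover have "(v - u) - (v - w) \<in> grade V (a + 1)" using assms w grade_diff by blast
  then have "w - u \<in> grade V (a + 1)" by (simp only: diff_diff_eq2 diff_add_eq) simp
  ultimately have "w - u = 0" by (rule grade_both)
  then show "w = u" by simp
qed (use assms in simp)

lemma component_props: "component V a v \<in> grade V a \<and> v - component V a v \<in> grade V (a + 1)"
proof -
  obtain v0 v1 where v: "v0 \<in> grade V 0" "v1 \<in> grade V 1" "v = v0 + v1"
    using grade_sum by blast
  then have "component V 0 v = v0" "component V 1 v = v1"
    by (intro component_unique; simp)+
  then show ?thesis using v by (cases a) auto
qed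

lemma component_grade [simp]: "component V a v \<in> grade V a"
  using component_props by blast

lemma component_add: "component V a (u + v) = component V a u + component V a v"
proof (rule component_unique)
  have "(u - component V a u) + (v - component V a v) \<in> grade V (a + 1)"
    using component_props grade_add by blast
  then show "u + v - (component V a u + component V a v) \<in> grade V (a + 1)"
    by (simp add: algebra_simps)
qed (simp add: grade_add)

lemma component_scl: "component V a (scl V c v) = scl V c (component V a v)"
proof (rule component_unique)
  show "scl V c v - scl V c (component V a v) \<in> grade V (a + 1)"
    using component_props[of a v] grade_scl by (simp flip: VS.scale_right_diff_distrib)
qed (simp add: grade_scl)

lemma component_homogeneous:
  "v \<in> grade V a \<Longrightarrow> component V b v = (if a = b then v else 0)"
  by (rule component_unique) (cases a; cases b; auto)+

lemma component_0 [simp]: "component V a 0 = 0"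
  using component_homogeneous[OF grade_0, of a a] by simp

lemma component_sum: "component V 0 v + component V 1 v = v"
proof -
  have "component V 1 v = v - component V 0 v"
    using component_props[of 0 v] component_unique[of "v - component V 0 v" 1 v] by simp
  then show ?thesis by simp
qed

end

section \<open>The action of the enveloping algebra\<close>

lemma koszul_0 [simp]: "koszul 0 b v = v" "koszul a 0 v = v"
  by (simp_all add: koszul_def)

lemma koszul_add: "koszul a b (u + v) = koszul a b u + koszul a b v"
  by (simp add: koszul_def)

lemma koszul_zero [simp]: "koszul a b 0 = 0"
  by (simp add: koszul_def)

context lie_super_module
begin

lemma act_add_right: "act x (m + n) = act x m + act x n"
  using act_linear_right[of x] by (rule linear_additive)

lemma act_scl_right: "act x (scl M c m) = scl M c (act x m)"
  using act_linear_right[of x] by (rule linear_homogeneous)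

lemma act_add_left: "act (x + y) m = act x m + act y m"
  using act_linear_left[of m] by (rule linear_additive)

lemma act_scl_left: "act (scl G c x) m = scl M c (act x m)"
  using act_linear_left[of m] by (rule linear_homogeneous)

lemma act_0 [simp]: "act x 0 = 0" "act 0 m = 0"
  using act_add_right[of x 0 0] act_add_left[of 0 0 m] by simp_all

lemma act_minus_right: "act x (- m) = - act x m"
  using act_add_right[of x "- m" m] by (simp add: eq_neg_iff_add_eq_0)

lemma foldr_act_linear:
  "foldr act xs (m + n) = foldr act xs m + foldr act xs n"
  "foldr act xs (scl M c m) = scl M c (foldr act xs m)"
  by (induction xs) (simp_all add: act_add_right act_scl_right)

lemma free_act_single: "free_act M act (Poly_Mapping.single w c) m = scl M c (foldr act (letters w) m)"
  by (cases "c = 0") (simp_all add: free_act_def)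

lemma free_act_0_left [simp]: "free_act M act 0 m = 0"
  by (simp add: free_act_def)

lemma free_act_add_left: "free_act M act (f + h) m = free_act M act f m + free_act M act h m"
  unfolding free_act_def
  by (rule setsum_keys_plus_distrib) (simp_all add: M.VS.scale_left_distrib)

lemma free_act_minus_left: "free_act M act (- f) m = - free_act M act f m"
  using free_act_add_left[of "- f" f m] by (simp add: eq_neg_iff_add_eq_0)

lemma free_act_diff_left: "free_act M act (f - h) m = free_act M act f m - free_act M act h m"
  unfolding diff_conv_add_uminus free_act_add_left free_act_minus_left ..

lemma free_act_add_right: "free_act M act f (m + n) = free_act M act f m + free_act M act f n"
  by (induction f rule: free_alg_induct)
    (simp_all add: free_act_single free_act_add_left foldr_act_linear M.VS.scale_right_distrib)

lemma free_act_scl_right: "free_act M act f (scl M c m) = scl M c (free_act M act f m)"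
  by (induction f rule: free_alg_induct)
    (simp_all add: free_act_single free_act_add_left foldr_act_linear M.VS.scale_right_distrib
      mult.commute)

lemma free_act_0_right [simp]: "free_act M act f 0 = 0"
  using free_act_add_right[of f 0 0] by simp

lemma free_act_mult: "free_act M act (f * h) m = free_act M act f (free_act M act h m)"
proof (induction f rule: free_alg_induct)
  case (single w c)
  show ?case
    by (induction h rule: free_alg_induct)
      (simp_all add: free_act_single free_act_add_left free_act_add_right mult_single plus_word_def
        foldr_act_linear distrib_left)
qed (simp_all add: free_act_add_left distrib_right)

lemma free_act_var [simp]: "free_act M act (free_var x) m = act x m"
  by (simp add: free_var_def free_act_single)

lemma free_act_var_power: "free_act M act (free_var x ^ n) m = (act x ^^ n) m"
  by (induction n arbitrary: m)
    (simp_all add: free_act_mult free_act_single zero_word_def flip: single_one)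

lemma free_act_scl_left: "free_act M act (free_scl c f) m = scl M c (free_act M act f m)"
  unfolding free_scl_def free_act_mult by (simp add: free_act_single zero_word_def)

text \<open>The elements that annihilate \<open>M\<close> form a two-sided ideal, and the module
  axioms put the defining relations of U(G) into it. Hence the action of the free algebra descends
  to U(G).\<close>

lemma free_act_env_ideal:
  assumes "f \<in> env_ideal G"
  shows "free_act M act f m = 0"
proof -
  let ?I = "{f. \<forall>m. free_act M act f m = 0}"
  interpret R: ring free_ring by (rule ring_free_ring)
  have "ideal ?I free_ring"
  proof (rule idealI[OF ring_free_ring])
    show "subgroup ?I (add_monoid free_ring)"
      by (rule group.subgroupI[OF R.a_group])
        (auto simp: free_act_add_left free_act_minus_left
            free_ring_minus[unfolded a_inv_def, simplified], metis free_act_0_left)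
  qed (auto simp: free_act_mult)
  moreover have "env_relations G \<subseteq> ?I"
    by (auto simp: env_relations_def free_act_diff_left act_add_left act_scl_left free_act_scl_left
        free_act_mult act_brkt koszul_def free_act_add_left)
  ultimately have "env_ideal G \<subseteq> ?I"
    unfolding env_ideal_def by (rule R.genideal_minimal)
  then show ?thesis using assms by blast
qed

lemma free_act_cong:
  "env_class G f = env_class G h \<Longrightarrow> free_act M act f m = free_act M act h m"
  using free_act_env_ideal[of "f - h" m] by (simp add: env_class_eq_iff free_act_diff_left)

lemma env_act_class: "env_act M act (env_class G f) m = free_act M act f m"
proof -
  have "env_class G f = (\<lambda>i. i + f) ` env_ideal G"
    by (auto simp: env_class_def a_r_coset_def')
  moreover have "0 \<in> env_ideal G" using env_class_eq_iff[of G 0 0] by simp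
  ultimately have "(\<lambda>h. free_act M act h m) ` env_class G f = {free_act M act f m}"
    by (auto simp: image_image free_act_add_left free_act_env_ideal)
  then show ?thesis by (simp add: env_act_def)
qed

end

section \<open>The extension of a cocycle\<close>

locale module_cocycle = lie_super_module G M act
  for G :: "('k::field, 'g::ab_group_add, 'y) lie_super_scheme"
    and M :: "('k, 'm::ab_group_add, 'z) super_space_scheme"
    and act :: "'g \<Rightarrow> 'm \<Rightarrow> 'm" +
  fixes g :: "('k, 'g) free_alg set \<Rightarrow> ('k, 'g) free_alg set \<Rightarrow> 'm"
  assumes cocycle: "g \<in> carrier (Z2 G M act)"
begin

definition coc :: "('k, 'g) free_alg \<Rightarrow> ('k, 'g) free_alg \<Rightarrow> 'm" where
  "coc f h = g (env_class G f) (env_class G h)"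

lemma coc_cong:
  "env_class G f = env_class G f' \<Longrightarrow> env_class G h = env_class G h' \<Longrightarrow> coc f h = coc f' h'"
  by (simp add: coc_def)

lemma even_bilinear: "even_bilinear_cochain G M g"
  using cocycle by (simp add: Z2_def)

lemma
  assumes "f \<in> free_plus G" "h \<in> free_plus G"
  shows coc_add_left: "f' \<in> free_plus G \<Longrightarrow> coc (f + f') h = coc f h + coc f' h"
    and coc_add_right: "h' \<in> free_plus G \<Longrightarrow> coc f (h + h') = coc f h + coc f h'"
    and coc_scl_left: "coc (free_scl c f) h = scl M c (coc f h)"
    and coc_scl_right: "coc f (free_scl c h) = scl M c (coc f h)"
    and coc_grade: "f \<in> free_grade G a \<Longrightarrow> h \<in> free_grade G b \<Longrightarrow> coc f h \<in> grade M (a + b)"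
    and coc_cocycle: "u \<in> free_plus G \<Longrightarrow>
      free_act M act f (coc h u) + coc f (h * u) = coc (f * h) u"
proof -
  note even_bilinear[unfolded even_bilinear_cochain_def]
  with assms show "f' \<in> free_plus G \<Longrightarrow> coc (f + f') h = coc f h + coc f' h"
    and "h' \<in> free_plus G \<Longrightarrow> coc f (h + h') = coc f h + coc f h'"
    and "coc (free_scl c f) h = scl M c (coc f h)"
    and "coc f (free_scl c h) = scl M c (coc f h)"
    and "f \<in> free_grade G a \<Longrightarrow> h \<in> free_grade G b \<Longrightarrow> coc f h \<in> grade M (a + b)"
    by (auto simp: coc_def env_class_add env_scl_class[symmetric] free_plus_def env_grade_def)
  show "free_act M act f (coc h u) + coc f (h * u) = coc (f * h) u" if "u \<in> free_plus G"
    using cocycle assms that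
    by (simp add: coc_def Z2_def env_class_mult env_act_class[symmetric] free_plus_def algebra_simps)
qed

lemma coc_0 [simp]:
  shows "f \<in> free_plus G \<Longrightarrow> coc f 0 = 0" and "f \<in> free_plus G \<Longrightarrow> coc 0 f = 0"
  using coc_add_right[of f 0 0] coc_add_left[of 0 f 0] by simp_all

lemma coc_diff_left:
  assumes "f \<in> free_plus G" "f' \<in> free_plus G" "h \<in> free_plus G"
  shows "coc (f - f') h = coc f h - coc f' h"
  using coc_add_left[of "f - f'" h f'] assms by (simp add: free_plus_diff)

lemma coc_diff_right:
  assumes "f \<in> free_plus G" "h \<in> free_plus G" "h' \<in> free_plus G"
  shows "coc f (h - h') = coc f h - coc f h'"
  using coc_add_right[of f "h - h'" h'] assms by (simp add: free_plus_diff)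

lemma coc_var_add:
  "h \<in> free_plus G \<Longrightarrow> coc (free_var (x + y)) h = coc (free_var x) h + coc (free_var y) h"
  "h \<in> free_plus G \<Longrightarrow> coc h (free_var (x + y)) = coc h (free_var x) + coc h (free_var y)"
  using coc_cong[OF env_class_var_add refl] coc_cong[OF refl env_class_var_add]
  by (simp_all add: coc_add_left coc_add_right)

lemma coc_var_scl:
  "h \<in> free_plus G \<Longrightarrow> coc (free_var (scl G c x)) h = scl M c (coc (free_var x) h)"
  "h \<in> free_plus G \<Longrightarrow> coc h (free_var (scl G c x)) = scl M c (coc h (free_var x))"
  using coc_cong[OF env_class_var_scl refl] coc_cong[OF refl env_class_var_scl]
  by (simp_all add: coc_scl_left coc_scl_right)

lemma coc_var_0 [simp]:
  "h \<in> free_plus G \<Longrightarrow> coc (free_var 0) h = 0" "h \<in> free_plus G \<Longrightarrow> coc h (free_var 0) = 0"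
  using coc_cong[OF env_class_var_0 refl] coc_cong[OF refl env_class_var_0] by simp_all

section \<open>The grading and the bracket of E_g\<close>

abbreviation "E \<equiv> cocycle_ext G M act g"
abbreviation "H \<equiv> cocycle_brkt_hom G act g"

lemma E_simps [simp]:
  "scl E c u = (scl G c (fst u), scl M c (snd u))"
  "grade E a = grade G a \<times> grade M a"
  by (simp_all add: cocycle_ext_def case_prod_beta)

lemma super_vector_space_E: "super_vector_space E"
proof -
  have vs: "vector_space (scl E)"
    by unfold_locales
      (simp_all add: G.VS.scale_left_distrib G.VS.scale_right_distrib
        M.VS.scale_left_distrib M.VS.scale_right_distrib)
  then interpret vector_space "scl E" .
  show ?thesis
  proof (intro super_vector_space.intro vs)
    show "module.subspace (scl E) (grade E a)" for a
      by (auto simp: subspace_def G.grade_add M.grade_add G.grade_scl M.grade_scl zero_prod_def)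
    show "grade E 0 \<inter> grade E 1 = {0}"
      using G.grade_disjoint M.grade_disjoint by (auto simp: zero_prod_def)
    show "\<exists>v0\<in>grade E 0. \<exists>v1\<in>grade E 1. v = v0 + v1" for v
    proof -
      obtain x0 x1 where "x0 \<in> grade G 0" "x1 \<in> grade G 1" "fst v = x0 + x1"
        using G.grade_sum by blast
      moreover obtain m0 m1 where "m0 \<in> grade M 0" "m1 \<in> grade M 1" "snd v = m0 + m1"
        using M.grade_sum by blast
      ultimately show ?thesis
        by (intro bexI[of _ "(x0, m0)"] bexI[of _ "(x1, m1)"]) (auto simp: prod_eq_iff)
    qed
  qed
qed

sublocale E: super_vector_space E
  by (rule super_vector_space_E)

lemma component_E: "component E a u = (component G a (fst u), component M a (snd u))"
  using G.component_props M.component_props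
  by (intro E.component_unique) (auto simp: prod_eq_iff mem_Times_iff)

lemma H_eq: "H a b u v = (brkt G (fst u) (fst v),
    act (fst u) (snd v) - koszul a b (act (fst v) (snd u)) +
    coc (free_var (fst u)) (free_var (fst v)) -
    koszul a b (coc (free_var (fst v)) (free_var (fst u))))"
  by (simp add: cocycle_brkt_hom_def case_prod_beta coc_def env_in_def)

lemma koszul_scl_M: "koszul a b (scl M c m) = scl M c (koszul a b m)"
  by (simp add: koszul_def M.VS.scale_minus_right)

lemmas brkt_add_left = linear_additive[OF G.brkt_linear_left]
lemmas brkt_add_right = linear_additive[OF G.brkt_linear_right]
lemmas brkt_scl_left = linear_homogeneous[OF G.brkt_linear_left]
lemmas brkt_scl_right = linear_homogeneous[OF G.brkt_linear_right]

lemma H_bilinear: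
  "H a b (u + u') v = H a b u v + H a b u' v"
  "H a b u (v + v') = H a b u v + H a b u v'"
  "H a b (scl E c u) v = scl E c (H a b u v)"
  "H a b u (scl E c v) = scl E c (H a b u v)"
  by (simp_all add: H_eq coc_var_add coc_var_scl act_add_left act_add_right act_scl_left
      act_scl_right koszul_add koszul_scl_M brkt_add_left brkt_add_right brkt_scl_left brkt_scl_right
      M.VS.scale_right_distrib M.VS.scale_right_diff_distrib algebra_simps)

lemma H_0 [simp]: "H a b 0 v = 0" "H a b u 0 = 0"
  using H_bilinear(1)[of a b 0 0 v] H_bilinear(2)[of a b u 0 0] by simp_all

lemma brkt_E: "brkt E u v =
    (\<Sum>a\<in>{0, 1}. \<Sum>b\<in>{0, 1}. H a b (component E a u) (component E b v))"
  unfolding component_E by (simp add: cocycle_ext_def case_prod_beta)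

lemma brkt_E_homogeneous:
  assumes "u \<in> grade E a" "v \<in> grade E b"
  shows "brkt E u v = H a b u v"
  unfolding brkt_E using E.component_homogeneous[OF assms(1)] E.component_homogeneous[OF assms(2)]
  by (cases a rule: bit_cases; cases b rule: bit_cases) simp_all

text \<open>Signs occur only between two odd elements. Against an even u the formulas for both
  parities of v coincide, and the sum over the components of v collapses by additivity.\<close>

lemma brkt_E_even_left:
  assumes "u \<in> grade E 0"
  shows "brkt E u v = H 0 0 u v"
proof -
  have "brkt E u v = H 0 0 u (component E 0 v) + H 0 1 u (component E 1 v)"
    unfolding brkt_E using E.component_homogeneous[OF assms] by simp
  also have "H 0 1 = H 0 0" by (simp add: fun_eq_iff H_eq)
  finally show ?thesis by (simp only: H_bilinear(2)[symmetric] E.component_sum)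
qed

lemma linear_brkt_E:
  "Vector_Spaces.linear (scl E) (scl E) (\<lambda>v. brkt E u v)"
  "Vector_Spaces.linear (scl E) (scl E) (\<lambda>u. brkt E u v)"
  by (unfold_locales;
      simp only: brkt_E E.component_add E.component_scl H_bilinear sum.distrib
        E.VS.scale_sum_right)+

section \<open>Operators representing the associative extension\<close>

text \<open>
  On the associative algebra $U(\mathfrak g)^+ \oplus M$ with product
  $(s,m)(t,n) = (st, s \cdot n + g(s,t))$ the bracket of $E_g$ is the supercommutator. An element
  $(s,m)$ is represented by an operator inducing left multiplication on the algebra with a unit
  adjoined; \<open>f\<close> is a representative of \<open>s\<close> in the free algebra.
\<close>

definition represents :: "(('k, 'g) free_alg, 'm) prod_endo \<Rightarrow> ('k, 'g) free_alg \<Rightarrow> 'm \<Rightarrow> bool" where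
  "represents T f m \<longleftrightarrow> f \<in> free_plus G \<and> (\<forall>h q.
     env_class G (fst (app T (h, q))) = env_class G (f * h) \<and> augment (fst (app T (h, q))) = 0 \<and>
     snd (app T (h, q)) = free_act M act f q + scl M (augment h) m + coc f (plus_part h))"

lemma representsD:
  assumes "represents T f m"
  shows "f \<in> free_plus G" "env_class G (fst (app T (h, q))) = env_class G (f * h)"
    "augment (fst (app T (h, q))) = 0"
    "snd (app T (h, q)) = free_act M act f q + scl M (augment h) m + coc f (plus_part h)"
  using assms by (auto simp: represents_def)

lemma plus_part_id: "augment f = 0 \<Longrightarrow> plus_part f = f"
  by (simp add: plus_part_def)

text \<open>With a unit adjoined, a right factor u is a scalar plus an element of U(G)^+. The
  cocycle is bilinear only on U(G)^+, so the two parts of u contribute separately.\<close>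

lemma coc_mult_right:
  assumes "f \<in> free_plus G" "h \<in> free_plus G"
  shows "coc f (h * u) = coc f (h * plus_part u) + scl M (augment u) (coc f h)"
proof -
  have "h * u = h * (plus_part u + Poly_Mapping.single 0 (augment u))"
    by (simp only: plus_part_eq)
  also have "\<dots> = h * plus_part u + free_scl (augment u) h"
    by (simp add: distrib_left free_scl_def single_0_commute)
  finally show ?thesis
    using assms by (simp add: coc_add_right coc_scl_right free_plus_mult_right free_plus_scl)
qed

text \<open>The cocycle identity \<open>coc_cocycle\<close> is the associativity of A; it is what
  lets a composition of left multiplications be the left multiplication by the product.\<close>

lemma represents_mult:
  assumes S: "represents S f m" and T: "represents T f' m'"
  shows "represents (S * T) (f * f') (free_act M act f m' + coc f f')"
  unfolding represents_def
proof (intro conjI allI)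
  note f = representsD(1)[OF S] and f' = representsD(1)[OF T]
  show "f * f' \<in> free_plus G" using f by (rule free_plus_mult_right)
  fix h q
  obtain h1 q1 where hq: "app T (h, q) = (h1, q1)" by fastforce
  note T' = representsD(2-)[OF T, of h q, unfolded hq fst_conv snd_conv]
  show "env_class G (fst (app (S * T) (h, q))) = env_class G (f * f' * h)"
    using representsD(2)[OF S, of h1 q1] env_class_cong(3)[OF refl T'(1), of f]
    by (simp add: hq mult.assoc)
  show "augment (fst (app (S * T) (h, q))) = 0"
    using representsD(3)[OF S, of h1 q1] by (simp add: hq)
  \<comment> \<open>\<open>h1\<close> is known only up to its class, that of \<open>f' * h\<close>.
    As its augmentation is 0, \<open>plus_part h1\<close> is \<open>h1\<close> itself, and
    \<open>coc f h1\<close> depends on the class alone.\<close>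
  have "coc f h1 = coc f (f' * plus_part h) + scl M (augment h) (coc f f')"
    using coc_cong[OF refl T'(1)] coc_mult_right[OF f f'] by metis
  then have "snd (app (S * T) (h, q)) = free_act M act f
      (free_act M act f' q + scl M (augment h) m' + coc f' (plus_part h)) +
      (coc f (f' * plus_part h) + scl M (augment h) (coc f f'))"
    using representsD(4)[OF S, of h1 q1] T'(2-) by (simp add: hq plus_part_id)
  also have "\<dots> = free_act M act (f * f') q +
      scl M (augment h) (free_act M act f m' + coc f f') + coc (f * f') (plus_part h)"
    unfolding coc_cocycle[OF f f' plus_part_in_free_plus, symmetric]
    by (simp add: free_act_add_right free_act_mult free_act_scl_right M.VS.scale_right_distrib)
  finally show "snd (app (S * T) (h, q)) = \<dots>" .
qed

lemma represents_add:
  assumes S: "represents S f m" and T: "represents T f' m'"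
  shows "represents (S + T) (f + f') (m + m')"
  using representsD[OF S] representsD[OF T] unfolding represents_def
  by (auto simp: free_plus_add env_class_add augment_add free_act_add_left distrib_right
      M.VS.scale_right_distrib coc_add_left plus_part_in_free_plus)

lemma represents_diff:
  assumes S: "represents S f m" and T: "represents T f' m'"
  shows "represents (S - T) (f - f') (m - m')"
  using representsD[OF S] representsD[OF T] unfolding represents_def
  by (auto simp: free_plus_diff env_class_diff augment_diff free_act_diff_left left_diff_distrib
      M.VS.scale_right_diff_distrib coc_diff_left plus_part_in_free_plus)

lemma represents_0: "represents 0 0 0"
  by (simp add: represents_def augment_def plus_part_in_free_plus)

lemma represents_koszul:
  "represents T f m \<Longrightarrow> represents (koszul a b T) (koszul a b f) (koszul a b m)"
  using represents_diff[OF represents_0, of T f m] by (simp add: koszul_def)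

lemma represents_cong:
  assumes T: "represents T f m" and eq: "env_class G f = env_class G f'" "m = m'"
  shows "represents T f' m'"
  using representsD[OF T] unfolding represents_def eq(2)[symmetric]
  by (auto simp: free_act_cong[OF eq(1)] coc_cong[OF eq(1) refl] env_class_mult eq(1)
      free_plus_def)

text \<open>Applied to the adjoined unit, that is to (1, 0), a representing operator returns the
  class of f and the element m, since \<open>plus_part 1 = 0\<close> removes the cocycle
  term.\<close>

lemma represents_unique:
  assumes "represents T f m" "represents T f' m'"
  shows "env_class G f = env_class G f'" "m = m'"
proof -
  have "plus_part 1 = (0 :: ('k, 'g) free_alg)" by (simp add: plus_part_def)
  then show "m = m'"
    using representsD(2,4)[OF assms(1), of 1 0] representsD(2,4)[OF assms(2), of 1 0]
      representsD(1)[OF assms(1)] representsD(1)[OF assms(2)] by simp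
  show "env_class G f = env_class G f'"
    using representsD(2,4)[OF assms(1), of 1 0] representsD(2,4)[OF assms(2), of 1 0]
      representsD(1)[OF assms(1)] representsD(1)[OF assms(2)] by simp
qed

text \<open>A relation and not a function of u: the commutator of two operators
  \<open>left_mult\<close> multiplies by xy - yx, which has the class of the letter [x,y] but is
  another element of the free algebra.\<close>

definition stands :: "(('k, 'g) free_alg, 'm) prod_endo \<Rightarrow> 'g \<times> 'm \<Rightarrow> bool" where
  "stands T u \<longleftrightarrow> represents T (free_var (fst u)) (snd u)"

definition left_mult :: "'g \<times> 'm \<Rightarrow> (('k, 'g) free_alg, 'm) prod_endo" where
  "left_mult u = Prod_endo (\<lambda>(h, q). (free_var (fst u) * h,
     act (fst u) q + scl M (augment h) (snd u) + coc (free_var (fst u)) (plus_part h)))"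

lemma stands_left_mult: "stands (left_mult u) u"
proof -
  have "app (left_mult u) = (\<lambda>(h, q). (free_var (fst u) * h,
     act (fst u) q + scl M (augment h) (snd u) + coc (free_var (fst u)) (plus_part h)))"
    unfolding left_mult_def
    by (rule app_Prod_endo)
      (auto simp: distrib_left act_add_right augment_add M.VS.scale_left_distrib plus_part_add
        coc_add_right plus_part_in_free_plus)
  then show ?thesis by (simp add: stands_def represents_def augment_mult)
qed

lemma stands_0: "stands 0 0"
  unfolding stands_def
  by (rule represents_cong[OF represents_0]) (simp_all add: env_class_var_0)

lemma stands_add: "stands S u \<Longrightarrow> stands T v \<Longrightarrow> stands (S + T) (u + v)"
  unfolding stands_def
  by (rule represents_cong[OF represents_add]) (auto simp: env_class_var_add)

text \<open>Only the \<open>M\<close>-components are concluded to be equal: for the first components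
  \<open>represents_unique\<close> yields an equality in U(G), not in \<open>G\<close>. First
  components are treated through \<open>fst_brkt_E\<close>.\<close>

lemma stands_unique: "stands T u \<Longrightarrow> stands T v \<Longrightarrow> snd u = snd v"
  unfolding stands_def by (rule represents_unique)

text \<open>The supercommutator of (x, m) and (y, n) in A has the \<open>M\<close>-component x.n +
  g(x,y) minus the signed y.m + g(y,x), which is the formula for the bracket of E_g.\<close>

lemma stands_koszul_brkt:
  assumes "stands S u" "stands T v" "u \<in> grade E a" "v \<in> grade E b"
  shows "stands (S * T - koszul a b (T * S)) (brkt E u v)"
proof -
  obtain x m where u: "u = (x, m)" by fastforce
  obtain y n where v: "v = (y, n)" by fastforce
  have S: "represents S (free_var x) m" and T: "represents T (free_var y) n"
    using assms(1,2) by (simp_all add: stands_def u v)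
  show ?thesis
    unfolding stands_def
    by (rule represents_cong[OF represents_diff[OF represents_mult[OF S T]
          represents_koszul[OF represents_mult[OF T S]]]])
      (use assms in \<open>auto simp: brkt_E_homogeneous H_eq env_class_var_brkt u v koszul_add\<close>)
qed

lemma env_class_var_diff: "env_class G (free_var (x - y)) = env_class G (free_var x - free_var y)"
  using env_class_cong(2)[OF env_class_var_add[of G "x - y" y] refl, of "free_var y"]
  by simp

lemma stands_diff: "stands S u \<Longrightarrow> stands T v \<Longrightarrow> stands (S - T) (u - v)"
  unfolding stands_def
  by (rule represents_cong[OF represents_diff]) (auto simp: env_class_var_diff)

lemma stands_koszul: "stands T u \<Longrightarrow> stands (koszul a b T) (koszul a b u)"
  using stands_diff[OF stands_0, of T u] by (simp add: koszul_def)

lemma brkt_E_grade: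
  assumes "u \<in> grade E a" "v \<in> grade E b"
  shows "brkt E u v \<in> grade E (a + b)"
proof -
  obtain x m y n where u: "u = (x, m)" and v: "v = (y, n)" by fastforce
  have x: "x \<in> grade G a" "m \<in> grade M a" and y: "y \<in> grade G b" "n \<in> grade M b"
    using assms by (simp_all add: u v)
  note coc = coc_grade[OF free_plus_var free_plus_var free_var_grade free_var_grade]
  have "act y m \<in> grade M (a + b)" "coc (free_var y) (free_var x) \<in> grade M (a + b)"
    using act_grade[OF y(1) x(2)] coc[OF y(1) x(1)] by (simp_all only: add.commute)
  then show ?thesis
    unfolding brkt_E_homogeneous[OF assms] H_eq
    using G.brkt_grade[OF x(1) y(1)] act_grade[OF x(1) y(2)] coc[OF x(1) y(1)]
    by (simp add: u v M.grade_add M.grade_diff M.grade_koszul)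
qed

lemma fst_brkt_E: "fst (brkt E u v) = brkt G (fst u) (fst v)"
proof -
  have "fst (brkt E u v) = brkt G (component G 0 (fst u) + component G 1 (fst u))
      (component G 0 (fst v) + component G 1 (fst v))"
    unfolding brkt_E by (simp add: H_eq component_E brkt_add_left brkt_add_right add_ac)
  then show ?thesis by (simp only: G.component_sum)
qed

theorem lie_superalgebra_E: "lie_superalgebra E"
proof (intro lie_superalgebra.intro super_vector_space_E lie_superalgebra_axioms.intro)
  show "Vector_Spaces.linear (scl E) (scl E) (\<lambda>y. brkt E x y)"
    "Vector_Spaces.linear (scl E) (scl E) (\<lambda>y. brkt E y x)" for x
    by (rule linear_brkt_E)+
next
  fix u v a b assume uv: "u \<in> grade E a" "v \<in> grade E b"
  then show "brkt E u v \<in> grade E (a + b)" by (rule brkt_E_grade)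
  show "brkt E u v = - koszul a b (brkt E v u)"
    unfolding brkt_E_homogeneous[OF uv] brkt_E_homogeneous[OF uv(2,1)] H_eq
    using uv G.skew[of "fst u" a "fst v" b]
    by (auto simp: koszul_def algebra_simps)
next
  fix u v w a b c assume uvw: "u \<in> grade E a" "v \<in> grade E b" "w \<in> grade E c"
  define S where "S = left_mult u"
  define T where "T = left_mult v"
  define W where "W = left_mult w"
  note st = stands_left_mult[of u, folded S_def] stands_left_mult[of v, folded T_def]
    stands_left_mult[of w, folded W_def]
  note br = stands_koszul_brkt and gr = brkt_E_grade
  have 1: "stands (S * (T * W - koszul b c (W * T)) - koszul a (b + c) ((T * W - koszul b c (W * T)) * S))
      (brkt E u (brkt E v w))"
    by (intro br st uvw gr)
  have 2: "stands ((S * T - koszul a b (T * S)) * W - koszul (a + b) c (W * (S * T - koszul a b (T * S)))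
      + koszul a b (T * (S * W - koszul a c (W * S)) - koszul b (a + c) ((S * W - koszul a c (W * S)) * T)))
      (brkt E (brkt E u v) w + koszul a b (brkt E v (brkt E u w)))"
    by (intro stands_add stands_koszul br st uvw gr)
  \<comment> \<open>The super Jacobi identity for supercommutators in an associative ring, expanded
    for each of the eight parity patterns.\<close>
  have eq: "S * (T * W - koszul b c (W * T)) - koszul a (b + c) ((T * W - koszul b c (W * T)) * S) =
      (S * T - koszul a b (T * S)) * W - koszul (a + b) c (W * (S * T - koszul a b (T * S)))
      + koszul a b (T * (S * W - koszul a c (W * S)) - koszul b (a + c) ((S * W - koszul a c (W * S)) * T))"
    by (cases a rule: bit_cases; cases b rule: bit_cases; cases c rule: bit_cases)
      (simp_all add: koszul_def algebra_simps)
  have "snd (brkt E u (brkt E v w)) = snd (brkt E (brkt E u v) w + koszul a b (brkt E v (brkt E u w)))"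
    using 1 2 unfolding eq by (rule stands_unique)
  moreover have "fst (brkt E u (brkt E v w)) =
      fst (brkt E (brkt E u v) w + koszul a b (brkt E v (brkt E u w)))"
    using G.jacobi[of "fst u" a "fst v" b "fst w" c] uvw
    by (auto simp: fst_brkt_E koszul_def)
  ultimately show "brkt E u (brkt E v w) =
      brkt E (brkt E u v) w + koszul a b (brkt E v (brkt E u w))"
    by (rule prod_eqI[rotated])
next
  fix v assume 3: "CHAR('k) = 3" and v: "v \<in> grade E 1"
  define T where "T = left_mult v"
  note st = stands_left_mult[of v, folded T_def]
  have "stands (T * (T * T - koszul 1 1 (T * T)) - koszul 1 (1 + 1) ((T * T - koszul 1 1 (T * T)) * T))
      (brkt E v (brkt E v v))"
    by (intro stands_koszul_brkt st v brkt_E_grade)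
  \<comment> \<open>For odd v the inner supercommutator is 2 T^2. It is even, so the outer one is an
    ordinary commutator, and T commutes with T^2.\<close>
  then have "stands 0 (brkt E v (brkt E v v))"
    by (simp add: koszul_def algebra_simps)
  then have "snd (brkt E v (brkt E v v)) = 0"
    using stands_unique[OF _ stands_0] by fastforce
  then show "brkt E v (brkt E v v) = 0"
    using G.cubic[OF 3, of "fst v"] v by (auto simp: prod_eq_iff fst_brkt_E)
qed

end

section \<open>Powers in the associative extension\<close>

lemma (in lie_superalgebra) env_class_var_brkt_even:
  assumes "x \<in> grade L 0"
  shows "env_class L (free_var (brkt L x y)) =
    env_class L (free_var x * free_var y - free_var y * free_var x)"
proof -
  let ?y = "\<lambda>a. component L a y"
  have y: "brkt L x y = brkt L x (?y 0) + brkt L x (?y 1)"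
    by (simp only: linear_additive[OF brkt_linear_right, symmetric] component_sum)
  have *: "env_class L (free_var (brkt L x (?y a))) =
      env_class L (free_var x * free_var (?y a) - free_var (?y a) * free_var x)" for a
    using env_class_var_brkt[of x L 0 "?y a" a] assms by simp
  have "env_class L (free_var (brkt L x y)) =
      env_class L (free_var x * (free_var (?y 0) + free_var (?y 1)) -
        (free_var (?y 0) + free_var (?y 1)) * free_var x)"
    unfolding y env_class_var_add
    using env_class_cong(1)[OF *[of 0] *[of 1]] by (simp add: algebra_simps)
  also have "\<dots> = env_class L (free_var x * free_var y - free_var y * free_var x)"
    using env_class_var_add[of L "?y 0" "?y 1"] component_sum[of y]
    by (intro env_class_cong) simp_all
  finally show ?thesis .
qed

lemma coeff_ad_pencil:
  assumes "brkt L x 0 = 0" "brkt L y 0 = 0"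
  shows "Polynomial.coeff (ad_pencil L x y q) n =
    (case n of 0 \<Rightarrow> 0 | Suc m \<Rightarrow> brkt L x (Polynomial.coeff q m)) + brkt L y (Polynomial.coeff q n)"
  using assms by (simp add: ad_pencil_def coeff_pCons coeff_map_poly split: nat.splits)

lemma ring_ad_pencil_nth: "ring_ad (pencil S T) f $ n =
    (case n of 0 \<Rightarrow> 0 | Suc m \<Rightarrow> ring_ad S (f $ m)) + ring_ad T (f $ n)"
  by (simp add: pencil_mult_nth mult_pencil_nth split: nat.splits)

lemma free_scl_mult: "free_scl c f * free_scl d h = free_scl (c * d) (f * h)"
proof -
  have "free_scl c f * free_scl d h =
      Poly_Mapping.single 0 c * (f * Poly_Mapping.single 0 d) * h"
    by (simp add: free_scl_def mult.assoc)
  also have "\<dots> = Poly_Mapping.single 0 c * (Poly_Mapping.single 0 d * f) * h"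
    by (simp only: single_0_commute[of d f])
  also have "\<dots> = (Poly_Mapping.single 0 c * Poly_Mapping.single 0 d) * (f * h)"
    by (simp only: mult.assoc)
  finally show ?thesis by (simp add: free_scl_def mult_single)
qed

lemma free_scl_pow: "free_scl c f ^ n = free_scl (c ^ n) (f ^ n)"
proof (induction n)
  case (Suc n)
  then show ?case by (simp add: free_scl_mult)
qed (simp add: free_scl_def)

lemma env_class_power_cong:
  "env_class G f = env_class G h \<Longrightarrow> env_class G (f ^ n) = env_class G (h ^ n)"
  by (simp add: env_class_pow)

context module_cocycle
begin

lemma stands_ad:
  assumes "stands S u" "stands T v" "u \<in> grade E 0"
  shows "stands (ring_ad S T) (brkt E u v)"
proof -
  have S: "represents S (free_var (fst u)) (snd u)" and T: "represents T (free_var (fst v)) (snd v)"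
    using assms(1,2) by (simp_all add: stands_def)
  show ?thesis
    unfolding stands_def
    by (rule represents_cong[OF represents_diff[OF represents_mult[OF S T] represents_mult[OF T S]]])
      (use assms(3) in \<open>auto simp: brkt_E_even_left H_eq G.env_class_var_brkt_even\<close>)
qed

lemma stands_ad_power:
  assumes "stands S u" "stands T v" "u \<in> grade E 0"
  shows "stands ((ring_ad S ^^ n) T) ((brkt E u ^^ n) v)"
proof (induction n)
  case (Suc n)
  then show ?case
    unfolding funpow.simps comp_def by (intro stands_ad assms(1,3))
qed (simp add: assms)

lemma brkt_E_0 [simp]: "brkt E u 0 = 0"
  using linear_additive[OF linear_brkt_E(1), of u 0 0] by simp

text \<open>The coefficients of \<open>ad_pencil\<close> in E_g and of the commutator with
  \<open>pencil S T\<close> obey the same recursion, so Jacobson's terms in the operator ring stand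
  for those in E_g.\<close>

lemma stands_coeff_ad_pencil:
  assumes "stands S u" "stands T v" "u \<in> grade E 0" "v \<in> grade E 0"
  shows "stands (((ring_ad (pencil S T) ^^ n) (fps_const S)) $ i)
    (Polynomial.coeff ((ad_pencil E u v ^^ n) [:u:]) i)"
proof (induction n arbitrary: i)
  case 0
  show ?case using assms by (auto simp: stands_0 coeff_pCons split: nat.splits)
next
  case (Suc n)
  show ?case
    unfolding funpow.simps comp_def ring_ad_pencil_nth
    by (subst coeff_ad_pencil)
      (auto intro!: stands_add stands_ad stands_0 assms Suc.IH split: nat.splits)
qed

lemma stands_of_nat:
  assumes "stands T u"
  shows "stands (of_nat n * T) (scl E (of_nat n) u)"
proof (induction n)
  case 0
  show ?case using stands_0 by (simp add: zero_prod_def)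
next
  case (Suc n)
  have "scl E (of_nat (Suc n)) u = u + scl E (of_nat n) u"
    by (simp add: G.VS.scale_left_distrib M.VS.scale_left_distrib prod_eq_iff)
  then show ?case
    using stands_add[OF assms Suc.IH] by (simp add: distrib_right del: E_simps)
qed

lemma stands_sum:
  "(\<And>i. i \<in> A \<Longrightarrow> stands (T i) (u i)) \<Longrightarrow> stands (\<Sum>i\<in>A. T i) (\<Sum>i\<in>A. u i)"
  by (induction A rule: infinite_finite_induct) (auto intro: stands_add stands_0)

lemma of_nat_char_prod_endo: "(of_nat CHAR('k) :: (('k, 'g) free_alg, 'm) prod_endo) = 0"
proof (rule prod_endo_eqI)
  fix v :: "('k, 'g) free_alg \<times> 'm"
  have *: "((+) v ^^ n) 0 = (of_nat n * fst v, scl M (of_nat n) (snd v))" for n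
    by (induction n)
      (simp_all add: prod_eq_iff algebra_simps M.VS.scale_left_distrib)
  have "(of_nat CHAR('k) :: ('k, 'g) free_alg) = Poly_Mapping.single 0 (of_nat CHAR('k))"
    by (rule single_of_nat[symmetric])
  also have "\<dots> = 0" by simp
  finally have "(of_nat CHAR('k) :: ('k, 'g) free_alg) = 0" .
  then show "app (of_nat CHAR('k)) v = app 0 v"
    unfolding app_of_nat * by (simp add: zero_prod_def)
qed

lemma fst_coeff_ad_pencil_E:
  "fst (Polynomial.coeff ((ad_pencil E u v ^^ n) [:u:]) i) =
    Polynomial.coeff ((ad_pencil G (fst u) (fst v) ^^ n) [:fst u:]) i"
proof (induction n arbitrary: i)
  case 0
  show ?case by (simp add: coeff_pCons split: nat.splits)
next
  case (Suc n)
  have "brkt G x 0 = 0" for x using fst_brkt_E[of "(x, 0)" 0] by simp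
  then show ?case
    by (simp add: coeff_ad_pencil fst_brkt_E Suc.IH split: nat.splits)
qed

lemma fst_jacobson_s_E: "fst (jacobson_s E i u v) = jacobson_s G i (fst u) (fst v)"
  by (simp add: jacobson_s_def fst_coeff_ad_pencil_E)

text \<open>Powers in U(G)^+ \<oplus> M start at the first, so the index n belongs to u^(n+1); the
  recursion is the product of u with that power.\<close>

primrec power_snd :: "'g \<times> 'm \<Rightarrow> nat \<Rightarrow> 'm" where
  "power_snd u 0 = snd u"
| "power_snd u (Suc n) = act (fst u) (power_snd u n) + coc (free_var (fst u)) (free_var (fst u) ^ Suc n)"

text \<open>The $M$-component of the $p$-th power of \<open>u\<close> in $U(\mathfrak g)^+ \oplus M$.\<close>

definition frob :: "'g \<times> 'm \<Rightarrow> 'm" where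
  "frob u = power_snd u (CHAR('k) - 1)"

lemma represents_power:
  assumes "stands S u"
  shows "represents (S ^ Suc n) (free_var (fst u) ^ Suc n) (power_snd u n)"
proof (induction n)
  case 0
  show ?case using assms by (simp add: stands_def)
next
  case (Suc n)
  show ?case
    using represents_mult[OF assms[unfolded stands_def] Suc.IH] by simp
qed

lemma power_snd_scl: "power_snd (scl E c u) n = scl M (c ^ Suc n) (power_snd u n)"
proof (induction n)
  case (Suc n)
  have "env_class G (free_var (scl G c (fst u)) ^ Suc n) =
      env_class G (free_scl (c ^ Suc n) (free_var (fst u) ^ Suc n))"
    unfolding free_scl_pow[symmetric] by (intro env_class_power_cong env_class_var_scl)
  then have "coc (free_var (scl G c (fst u))) (free_var (scl G c (fst u)) ^ Suc n) =
      scl M (c ^ Suc (Suc n)) (coc (free_var (fst u)) (free_var (fst u) ^ Suc n))"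
    using coc_cong[OF refl, of "free_var (scl G c (fst u)) ^ Suc n"
        "free_scl (c ^ Suc n) (free_var (fst u) ^ Suc n)" "free_var (scl G c (fst u))"]
    by (simp add: coc_scl_right coc_var_scl free_plus_power free_plus_mult_right mult_ac
        del: power_Suc) (simp add: mult_ac)
  with Suc.IH show ?case
    by (simp add: act_scl_left act_scl_right M.VS.scale_right_distrib mult_ac)
qed simp

lemma frob_scl:
  assumes "CHAR('k) > 0"
  shows "frob (scl E c u) = scl M (c ^ CHAR('k)) (frob u)"
proof -
  have "Suc (CHAR('k) - 1) = CHAR('k)" using assms by simp
  then show ?thesis unfolding frob_def power_snd_scl by (rule arg_cong)
qed

text \<open>Two elements of the form (0, m) have product zero in A, so every power beyond the first
  vanishes; p > 1 provides at least one multiplication.\<close>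

lemma frob_ideal: "CHAR('k) > 1 \<Longrightarrow> frob (0, m) = 0"
  unfolding frob_def by (cases "CHAR('k) - 1") (simp_all add: free_plus_mult_right)

lemma power_snd_grade:
  assumes "u \<in> grade E 0"
  shows "power_snd u n \<in> grade M 0"
proof (induction n)
  case (Suc n)
  have "fst u \<in> grade G 0" using assms by auto
  then show ?case
    using act_grade[of "fst u" 0 "power_snd u n" 0] Suc.IH
      coc_grade[of "free_var (fst u)" "free_var (fst u) ^ Suc n" 0 0]
      free_var_power_grade[of "fst u" G 0 "Suc n"]
    by (auto intro!: M.grade_add simp: free_plus_power free_var_grade simp del: power_Suc)
qed (use assms in auto)

lemma frob_grade: "u \<in> grade E 0 \<Longrightarrow> frob u \<in> grade M 0"
  unfolding frob_def by (rule power_snd_grade)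

lemma represents_frob:
  assumes "stands S u" "CHAR('k) > 0"
  shows "represents (S ^ CHAR('k)) (free_var (fst u) ^ CHAR('k)) (frob u)"
proof -
  have "CHAR('k) = Suc (CHAR('k) - 1)" using assms(2) by simp
  then show ?thesis
    using represents_power[OF assms(1), of "CHAR('k) - 1"] unfolding frob_def by metis
qed

lemma stands_jacobson_s:
  assumes "stands S u" "stands T v" "u \<in> grade E 0" "v \<in> grade E 0"
    and i: "i \<in> {1..CHAR('k) - 1}" and p: "CHAR('k) > 0"
  shows "stands ((pencil S T ^ CHAR('k)) $ i) (jacobson_s E i u v)"
proof -
  let ?p = "CHAR('k)" and ?C = "(pencil S T ^ CHAR('k)) $ i"
  let ?D = "((ring_ad (pencil S T) ^^ (?p - 1)) (fps_const S)) $ (i - 1)"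
  have prime: "prime ?p" using p by (rule prime_CHAR_semidom)
  have "\<not> ?p dvd i" using i by (auto dest: dvd_imp_le)
  then have "coprime i ?p"
    using prime_imp_coprime[OF prime, of i] by (simp add: coprime_commute)
  \<comment> \<open>Jacobson's formula determines only i times the coefficient. The operators have
    no scalars from \<open>'k\<close>, so the factor \<open>inverse (of_nat i)\<close> of
    \<open>jacobson_s\<close> is realised by a natural number j inverse to i modulo p.\<close>
  then obtain j l where jl: "i * j = ?p * l + 1"
    using prime coprime_bezout_strong[of i ?p] by auto
  have C: "of_nat i * ?C = ?D"
    using i by (intro jacobson_formula(2)[OF prime of_nat_char_prod_endo]) auto
  have "?C = of_nat (i * j) * ?C"
    unfolding jl by (simp add: of_nat_char_prod_endo)
  also have "\<dots> = of_nat j * ?D"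
    unfolding C[symmetric] by (simp add: mult.commute[of i j] mult.assoc)
  finally have C': "?C = of_nat j * ?D" .
  have "of_nat i * of_nat j = (1 :: 'k)"
    using arg_cong[OF jl, of "of_nat :: nat \<Rightarrow> 'k"] by simp
  then have "inverse (of_nat i) = (of_nat j :: 'k)" by (rule inverse_unique)
  then show ?thesis
    unfolding C' jacobson_s_def
    using stands_of_nat[OF stands_coeff_ad_pencil[OF assms(1-4)]] by simp
qed

text \<open>The p-th power of S + T is represented once directly and once through Jacobson's
  formula. Comparing the two gives the first claim in \<open>M\<close> and the second in
  U(G).\<close>

lemma power_char_add:
  assumes u: "u \<in> grade E 0" and v: "v \<in> grade E 0" and p: "CHAR('k) > 0"
  shows "frob (u + v) = frob u + frob v + (\<Sum>i = 1..CHAR('k) - 1. snd (jacobson_s E i u v))"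
    and "env_class G (free_var (fst (u + v)) ^ CHAR('k)) =
      env_class G (free_var (fst u) ^ CHAR('k) + free_var (fst v) ^ CHAR('k) +
        free_var (\<Sum>i = 1..CHAR('k) - 1. jacobson_s G i (fst u) (fst v)))"
proof -
  let ?p = "CHAR('k)"
  define S where "S = left_mult u"
  define T where "T = left_mult v"
  note st = stands_left_mult[of u, folded S_def] stands_left_mult[of v, folded T_def]
  have prime: "prime ?p" using p by (rule prime_CHAR_semidom)
  have "stands (\<Sum>i=1..?p-1. (pencil S T ^ ?p) $ i) (\<Sum>i=1..?p-1. jacobson_s E i u v)"
    by (intro stands_sum stands_jacobson_s st u v p)
  then have "represents ((S + T) ^ ?p)
      (free_var (fst u) ^ ?p + free_var (fst v) ^ ?p + free_var (fst (\<Sum>i=1..?p-1. jacobson_s E i u v)))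
      (frob u + frob v + snd (\<Sum>i=1..?p-1. jacobson_s E i u v))"
    unfolding jacobson_formula(1)[OF prime of_nat_char_prod_endo, of S T] stands_def
    by (intro represents_add represents_frob st p)
  note * = represents_unique[OF represents_frob[OF stands_add[OF st] p] this]
  show "frob (u + v) = frob u + frob v + (\<Sum>i = 1..?p - 1. snd (jacobson_s E i u v))"
    using *(2) by (simp add: snd_sum)
  show "env_class G (free_var (fst (u + v)) ^ ?p) =
      env_class G (free_var (fst u) ^ ?p + free_var (fst v) ^ ?p +
        free_var (\<Sum>i = 1..?p - 1. jacobson_s G i (fst u) (fst v)))"
    using *(1) by (simp add: fst_sum fst_jacobson_s_E)
qed

text \<open>Both are read off from ad(S)^p T = [S^p, T]: iterated brackets stand for the left side,
  and the right side is computed with S^p represented by x^p and \<open>frob u\<close>.\<close>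

lemma
  assumes u: "u \<in> grade E 0" and p: "CHAR('k) > 0"
  shows snd_ad_power_char: "snd ((brkt E u ^^ CHAR('k)) v) =
    (act (fst u) ^^ CHAR('k)) (snd v) - act (fst v) (frob u) +
    coc (free_var (fst u) ^ CHAR('k)) (free_var (fst v)) -
    coc (free_var (fst v)) (free_var (fst u) ^ CHAR('k))"
    and env_class_ad_power_char: "env_class G (free_var ((brkt G (fst u) ^^ CHAR('k)) (fst v))) =
    env_class G (free_var (fst u) ^ CHAR('k) * free_var (fst v) -
      free_var (fst v) * free_var (fst u) ^ CHAR('k))"
proof -
  let ?p = "CHAR('k)"
  define S where "S = left_mult u"
  define T where "T = left_mult v"
  note st = stands_left_mult[of u, folded S_def] stands_left_mult[of v, folded T_def]
  have prime: "prime ?p" using p by (rule prime_CHAR_semidom)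
  note P = represents_frob[OF st(1) p] and T = st(2)[unfolded stands_def]
  have "represents ((ring_ad S ^^ ?p) T) (free_var (fst ((brkt E u ^^ ?p) v))) (snd ((brkt E u ^^ ?p) v))"
    using stands_ad_power[OF st u, of ?p] by (simp add: stands_def)
  note * = represents_unique[OF this, unfolded ad_power_char[OF prime of_nat_char_prod_endo, of S T],
      OF represents_diff[OF represents_mult[OF P T] represents_mult[OF T P]]]
  have "fst ((brkt E u ^^ n) v) = (brkt G (fst u) ^^ n) (fst v)" for n
    by (induction n) (simp_all add: fst_brkt_E)
  with * show "snd ((brkt E u ^^ ?p) v) =
    (act (fst u) ^^ ?p) (snd v) - act (fst v) (frob u) +
    coc (free_var (fst u) ^ ?p) (free_var (fst v)) - coc (free_var (fst v)) (free_var (fst u) ^ ?p)"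
    and "env_class G (free_var ((brkt G (fst u) ^^ ?p) (fst v))) =
      env_class G (free_var (fst u) ^ ?p * free_var (fst v) - free_var (fst v) * free_var (fst u) ^ ?p)"
    by (simp_all add: free_act_var_power algebra_simps)
qed

end

section \<open>The obstruction to a restricted structure\<close>

locale restricted_module_cocycle =
  restricted_module G M act + module_cocycle G M act g
  for G :: "('k::field, 'g::ab_group_add, 'y) restricted_lie_super_scheme"
    and M :: "('k, 'm::ab_group_add, 'z) super_space_scheme"
    and act :: "'g \<Rightarrow> 'm \<Rightarrow> 'm"
    and g :: "('k, 'g) free_alg set \<Rightarrow> ('k, 'g) free_alg set \<Rightarrow> 'm" +
  assumes char_pos: "CHAR('k) > 0"
begin

lemma prime_char: "prime CHAR('k)"
  using char_pos by (rule prime_CHAR_semidom)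

definition pow_diff :: "'g \<Rightarrow> ('k, 'g) free_alg" where
  "pow_diff x = free_var x ^ CHAR('k) - free_var (pmap G x)"

definition obstruction :: "'g \<Rightarrow> 'g \<Rightarrow> 'm" where
  "obstruction x y = coc (pow_diff x) (free_var y) - coc (free_var y) (pow_diff x)"

lemma env_class_pow_diff:
  "env_class G (pow_diff x) = env_in G x [^]\<^bsub>Env G\<^esub> CHAR('k) \<ominus>\<^bsub>Env G\<^esub> env_in G (pmap G x)"
  by (simp add: pow_diff_def env_class_diff env_class_pow env_in_def)

lemma Phi_cochain_eq: "Phi_cochain G g x = obstruction x"
  by (simp add: Phi_cochain_def obstruction_def coc_def env_class_pow_diff Let_def fun_eq_iff env_in_def)

lemma pow_diff_plus [simp]: "pow_diff x \<in> free_plus G"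
  unfolding pow_diff_def using char_pos by (intro free_plus_diff free_plus_power free_plus_var)

lemma pow_diff_grade: "x \<in> grade G 0 \<Longrightarrow> pow_diff x \<in> free_grade G 0"
  unfolding pow_diff_def
  by (intro free_grade_diff free_var_power_grade free_var_grade G.pmap_even) auto

lemma free_act_pow_diff: "x \<in> grade G 0 \<Longrightarrow> free_act M act (pow_diff x) m = 0"
  by (simp add: pow_diff_def free_act_diff_left free_act_var_power act_pmap)

text \<open>The element (ad x)^p y of \<open>G\<close> maps to the commutator of x^p with y by
  \<open>env_class_ad_power_char\<close>, and to that of x^{[p]} with y by the axiom on the
  p-map.\<close>

lemma pow_diff_central:
  assumes "x \<in> grade G 0"
  shows "env_class G (pow_diff x * free_var y) = env_class G (free_var y * pow_diff x)"
proof -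
  have "(x, 0) \<in> grade E 0" using assms by simp
  from env_class_ad_power_char[OF this char_pos, of "(y, 0)"]
  have "env_class G (free_var (brkt G (pmap G x) y)) =
      env_class G (free_var x ^ CHAR('k) * free_var y - free_var y * free_var x ^ CHAR('k))"
    by (simp add: G.brkt_pmap[OF assms])
  then have "env_class G (free_var (pmap G x) * free_var y - free_var y * free_var (pmap G x)) =
      env_class G (free_var x ^ CHAR('k) * free_var y - free_var y * free_var x ^ CHAR('k))"
    using G.env_class_var_brkt_even[OF G.pmap_even[OF assms], of y] by simp
  from this[symmetric] show ?thesis
    by (simp add: env_class_eq_iff pow_diff_def algebra_simps)
qed

text \<open>The first components agree by \<open>brkt_pmap\<close> in \<open>G\<close>, and the
  terms in \<open>snd v\<close> cancel because \<open>M\<close> is a restricted module. The other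
  terms regroup into the stated equation.\<close>

lemma ad_power_char_iff:
  assumes "x \<in> grade G 0" "m \<in> grade M 0" "c \<in> grade M 0"
  shows "(brkt E (x, m) ^^ CHAR('k)) v = brkt E (pmap G x, c) v \<longleftrightarrow>
    obstruction x (fst v) = act (fst v) (frob (x, m) - c)"
proof -
  have xm: "(x, m) \<in> grade E 0" and xc: "(pmap G x, c) \<in> grade E 0"
    using assms G.pmap_even by simp_all
  have fst: "fst ((brkt E (x, m) ^^ n) v) = (brkt G x ^^ n) (fst v)" for n
    by (induction n) (simp_all add: fst_brkt_E)
  have act: "act (fst v) (frob (x, m) - c) = act (fst v) (frob (x, m)) - act (fst v) c"
    using act_add_right[of "fst v" "frob (x, m) - c" c] by simp
  show ?thesis
    unfolding prod_eq_iff fst snd_ad_power_char[OF xm char_pos] brkt_E_even_left[OF xc] H_eq act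
    using char_pos
    by (simp add: G.brkt_pmap[OF assms(1)] act_pmap[OF assms(1)] obstruction_def pow_diff_def
        coc_diff_left coc_diff_right free_plus_power algebra_simps)
qed

text \<open>Jacobson's formula in U(G) and the additivity axiom of the p-map contribute the same sum
  \<open>?s\<close>, which cancels in the difference.\<close>

lemma pow_diff_add:
  assumes "x \<in> grade G 0" "y \<in> grade G 0"
  shows "env_class G (pow_diff (x + y)) = env_class G (pow_diff x + pow_diff y)"
proof -
  let ?s = "\<Sum>i = 1..CHAR('k) - 1. jacobson_s G i x y"
  have "(x, 0) \<in> grade E 0" "(y, 0) \<in> grade E 0" using assms by simp_all
  from power_char_add(2)[OF this char_pos]
  have 1: "env_class G (free_var (x + y) ^ CHAR('k)) =
      env_class G (free_var x ^ CHAR('k) + free_var y ^ CHAR('k) + free_var ?s)" by simp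
  have 2: "env_class G (free_var (pmap G (x + y))) =
      env_class G (free_var (pmap G x) + free_var (pmap G y) + free_var ?s)"
    unfolding G.pmap_add[OF assms]
    by (simp add: env_class_var_add env_class_add)
  show ?thesis
    unfolding pow_diff_def env_class_cong(2)[OF 1 2] by (simp add: algebra_simps)
qed

lemma pow_diff_scl:
  assumes "x \<in> grade G 0"
  shows "env_class G (pow_diff (scl G c x)) = env_class G (free_scl (c ^ CHAR('k)) (pow_diff x))"
proof -
  interpret vector_space free_scl by (rule vector_space_free_scl)
  have "env_class G (free_var (scl G c x) ^ CHAR('k)) =
      env_class G (free_scl (c ^ CHAR('k)) (free_var x ^ CHAR('k)))"
    unfolding free_scl_pow[symmetric] by (intro env_class_power_cong env_class_var_scl)
  from env_class_cong(2)[OF this env_class_var_scl] show ?thesis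
    by (simp add: pow_diff_def G.pmap_scl[OF assms] scale_right_diff_distrib)
qed

lemma obstruction_add:
  "x \<in> grade G 0 \<Longrightarrow> y \<in> grade G 0 \<Longrightarrow> obstruction (x + y) z = obstruction x z + obstruction y z"
  using coc_cong[OF pow_diff_add refl, of x y "free_var z"]
    coc_cong[OF refl pow_diff_add, of x y "free_var z"]
  by (simp add: obstruction_def coc_add_left coc_add_right)

lemma obstruction_scl:
  assumes "x \<in> grade G 0"
  shows "obstruction (scl G c x) z = scl M (c ^ CHAR('k)) (obstruction x z)"
proof -
  have "coc (pow_diff (scl G c x)) (free_var z) =
      coc (free_scl (c ^ CHAR('k)) (pow_diff x)) (free_var z)"
    "coc (free_var z) (pow_diff (scl G c x)) =
      coc (free_var z) (free_scl (c ^ CHAR('k)) (pow_diff x))"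
    by (intro coc_cong pow_diff_scl[OF assms] refl)+
  then show ?thesis
    by (simp add: obstruction_def coc_scl_left coc_scl_right M.VS.scale_right_diff_distrib)
qed

text \<open>
  Primitives of the obstruction chosen on a basis extend semilinearly: such an extension is a
  linear map into \<open>M\<close> with scalars acting through the Frobenius endomorphism.
\<close>

lemma semilinear_primitive:
  assumes "\<And>x. x \<in> grade G 0 \<Longrightarrow> obstruction x \<in> B1 M act"
  obtains c where "\<And>x. x \<in> grade G 0 \<Longrightarrow> c x \<in> grade M 0"
    "\<And>x y. x \<in> grade G 0 \<Longrightarrow> obstruction x y = act y (c x)"
    "\<And>x y. c (x + y) = c x + c y" "\<And>a x. c (scl G a x) = scl M (a ^ CHAR('k)) (c x)"
proof -
  let ?s = "\<lambda>a. scl M (a ^ CHAR('k))"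
  have vs: "vector_space ?s"
    by unfold_locales (use char_pos in \<open>simp_all add: M.VS.scale_right_distrib power_mult_distrib
        freshmans_dream[OF prime_char refl] M.VS.scale_left_distrib\<close>)
  interpret P: vector_space_pair "scl G" ?s
    by (intro vector_space_pair.intro vs G.vector_space)
  obtain B where B: "B \<subseteq> grade G 0" "G.VS.independent B" "grade G 0 \<subseteq> G.VS.span B"
    using G.VS.maximal_independent_subset by blast
  have "\<forall>x\<in>B. \<exists>m. m \<in> grade M 0 \<and> obstruction x = (\<lambda>y. act y m)"
    using assms B(1) by (auto simp: B1_def)
  then obtain c0 where c0: "\<And>x. x \<in> B \<Longrightarrow> c0 x \<in> grade M 0 \<and> obstruction x = (\<lambda>y. act y (c0 x))"
    by metis
  obtain c where c: "Vector_Spaces.linear (scl G) ?s c" "\<And>x. x \<in> B \<Longrightarrow> c x = c0 x"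
    using P.linear_independent_extend[OF B(2), of c0] by auto
  note c_add = linear_additive[OF c(1)] and c_scl = linear_homogeneous[OF c(1)]
  \<comment> \<open>The obstruction is known to be semilinear only on the even part, so
    \<open>?Q\<close> includes membership in \<open>grade G 0\<close>. The conditions cut out a
    subspace, hence checking them on \<open>B\<close> suffices.\<close>
  let ?Q = "\<lambda>x. x \<in> grade G 0 \<and> c x \<in> grade M 0 \<and> (\<forall>y. obstruction x y = act y (c x))"
  have "c 0 = 0" "obstruction 0 y = 0" for y
    using c_add[of 0 0] obstruction_add[of 0 0 y] by simp_all
  then have "G.VS.subspace {x. ?Q x}"
    unfolding G.VS.subspace_def
    by (auto simp: G.grade_add G.grade_scl c_add c_scl obstruction_add obstruction_scl
        M.grade_add M.grade_scl act_add_right act_scl_right)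
  moreover have "B \<subseteq> {x. ?Q x}" using B(1) c0 c(2) by auto
  ultimately have "grade G 0 \<subseteq> {x. ?Q x}"
    using B(3) G.VS.span_minimal by blast
  then show ?thesis by (intro that[of c] c_add c_scl) auto
qed

definition restricted_E :: "('g \<Rightarrow> 'm) \<Rightarrow> ('k, 'g \<times> 'm) restricted_lie_super" where
  "restricted_E c = \<lparr>scl = scl E, grade = grade E, brkt = brkt E,
     pmap = (\<lambda>u. (pmap G (fst u), frob u - c (fst u)))\<rparr>"

lemma restricted_E_sel:
  "scl (restricted_E c) = scl E" "grade (restricted_E c) = grade E"
  "brkt (restricted_E c) = brkt E" "pmap (restricted_E c) u = (pmap G (fst u), frob u - c (fst u))"
  by (simp_all add: restricted_E_def)

lemma restricted_lie_superalgebra_E: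
  assumes c_even: "\<And>x. x \<in> grade G 0 \<Longrightarrow> c x \<in> grade M 0"
    and obstruction: "\<And>x y. x \<in> grade G 0 \<Longrightarrow> obstruction x y = act y (c x)"
    and c_add: "\<And>x y. c (x + y) = c x + c y"
    and c_scl: "\<And>a x. c (scl G a x) = scl M (a ^ CHAR('k)) (c x)"
  shows "restricted_lie_superalgebra (restricted_E c)"
proof (intro restricted_lie_superalgebra.intro restricted_lie_superalgebra_axioms.intro)
  show "lie_superalgebra (restricted_E c)"
    using lie_superalgebra_E
    unfolding lie_superalgebra_def lie_superalgebra_axioms_def super_vector_space_def
      restricted_E_sel .
next
  fix u :: "'g \<times> 'm" and a v
  assume "u \<in> grade (restricted_E c) 0"
  then have u: "u \<in> grade E 0" by (simp only: restricted_E_sel)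
  then have x: "fst u \<in> grade G 0" and m: "snd u \<in> grade M 0" by auto
  show "pmap (restricted_E c) u \<in> grade (restricted_E c) 0"
    using G.pmap_even[OF x] frob_grade[OF u] c_even[OF x]
    by (simp add: restricted_E_sel M.grade_diff)
  show "pmap (restricted_E c) (scl (restricted_E c) a u) =
      scl (restricted_E c) (a ^ CHAR('k)) (pmap (restricted_E c) u)"
    using frob_scl[OF char_pos, of a u]
    by (simp add: restricted_E_sel G.pmap_scl[OF x] c_scl M.VS.scale_right_diff_distrib)
  show "brkt (restricted_E c) (pmap (restricted_E c) u) v =
      (brkt (restricted_E c) u ^^ CHAR('k)) v"
    using ad_power_char_iff[OF x m, of "frob u - c (fst u)" v] obstruction[OF x] frob_grade[OF u]
      c_even[OF x]
    by (simp add: restricted_E_sel M.grade_diff)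
next
  fix u v :: "'g \<times> 'm"
  assume "u \<in> grade (restricted_E c) 0" "v \<in> grade (restricted_E c) 0"
  then have u: "u \<in> grade E 0" and v: "v \<in> grade E 0" by (simp_all only: restricted_E_sel)
  then have x: "fst u \<in> grade G 0" and y: "fst v \<in> grade G 0" by auto
  have s: "jacobson_s (restricted_E c) i u v = jacobson_s E i u v" for i
    by (simp add: jacobson_s_def ad_pencil_def[abs_def] restricted_E_sel)
  show "pmap (restricted_E c) (u + v) = pmap (restricted_E c) u + pmap (restricted_E c) v +
      (\<Sum>i = 1..CHAR('k) - 1. jacobson_s (restricted_E c) i u v)"
    by (simp add: s restricted_E_sel prod_eq_iff fst_sum snd_sum fst_jacobson_s_E
        G.pmap_add[OF x y] power_char_add(1)[OF u v char_pos] c_add)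
qed

lemma brkt_E_ideal: "brkt E u (0, m) = (0, act (fst u) m)"
proof -
  have "brkt G x 0 = 0" for x
    using linear_additive[OF G.brkt_linear_right[of x], of 0 0] by simp
  then have "brkt E u (0, m) = (0, act (component G 0 (fst u) + component G 1 (fst u))
      (component M 0 m + component M 1 m))"
    unfolding brkt_E component_E
    by (simp add: H_eq act_add_left act_add_right add_ac)
  then show ?thesis by (simp only: G.component_sum M.component_sum)
qed

end

section \<open>Cohomology classes and the kernel of Phi\<close>

context lie_super_module
begin

lemma B1_I: "m \<in> grade M 0 \<Longrightarrow> (\<lambda>x. act x m) \<in> B1 M act"
  by (auto simp: B1_def)

lemma zero_in_B1: "(\<lambda>x. 0) \<in> B1 M act"
  using B1_I[of 0] by simp

lemma H1_class_eq: "H1_class G M act h = {\<lambda>x. b x + h x | b. b \<in> B1 M act}"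
  by (auto simp: H1_class_def r_coset_def Z1_def)

lemma H1_class_B1:
  assumes "h \<in> B1 M act"
  shows "H1_class G M act h = B1 M act"
proof -
  obtain m where m: "m \<in> grade M 0" "h = (\<lambda>x. act x m)" using assms by (auto simp: B1_def)
  show ?thesis
  proof (intro equalityI subsetI)
    fix k assume "k \<in> H1_class G M act h"
    then obtain n where "n \<in> grade M 0" "k = (\<lambda>x. act x (n + m))"
      by (auto simp: H1_class_eq B1_def m act_add_right)
    then show "k \<in> B1 M act" using m by (auto intro!: B1_I M.grade_add)
  next
    fix k assume "k \<in> B1 M act"
    then obtain n where n: "n \<in> grade M 0" "k = (\<lambda>x. act x n)" by (auto simp: B1_def)
    have "k = (\<lambda>x. act x (n - m) + h x)"
      by (simp add: n m act_add_right[symmetric])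
    then show "k \<in> H1_class G M act h"
      using B1_I[OF M.grade_diff[OF n(1) m(1)]] by (auto simp: H1_class_eq)
  qed
qed

end

lemma restrict_eq_iff: "restrict f A = restrict h A \<longleftrightarrow> (\<forall>x\<in>A. f x = h x)"
  by (auto simp: restrict_def fun_eq_iff)

context restricted_module_cocycle
begin

lemma H2_class_eq: "H2_class G M act g = {\<lambda>s t. b s t + g s t | b. b \<in> B2 G M act}"
  by (auto simp: H2_class_def r_coset_def Z2_def)

lemma self_in_H2_class: "g \<in> H2_class G M act g"
proof -
  have "(\<lambda>s t. 0) \<in> B2 G M act"
    unfolding B2_def
  proof (intro CollectI exI[of _ "\<lambda>s. 0"] conjI ext)
    show "even_linear_cochain G M (\<lambda>s. 0)" by (simp add: even_linear_cochain_def)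
  next
    fix s t
    have "env_act M act s 0 = 0" if "s \<in> Env_plus G"
      using that by (auto elim!: Env_plusE simp: env_act_class)
    then show "0 = (if s \<in> Env_plus G \<and> t \<in> Env_plus G then env_act M act s 0 - 0 else 0)"
      by simp
  qed
  then show ?thesis unfolding H2_class_eq by force
qed

text \<open>The coboundary of h changes the cochain at y by z.h(y) - h(zy) - y.h(z) + h(yz). As z
  kills \<open>M\<close> and is central, only -y.h(z) is left, so m = -h(z); it is even because z
  is.\<close>

lemma Phi_cochain_coboundary:
  assumes "b \<in> B2 G M act" "x \<in> grade G 0"
  obtains m where "m \<in> grade M 0"
    "Phi_cochain G (\<lambda>s t. b s t + g s t) x = (\<lambda>y. act y m + obstruction x y)"
proof -
  obtain h where h: "even_linear_cochain G M h"
    and b: "b = (\<lambda>s t. if s \<in> Env_plus G \<and> t \<in> Env_plus G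
              then env_act M act s (h t) - h (s \<otimes>\<^bsub>Env G\<^esub> t) else 0)"
    using assms(1) by (auto simp: B2_def)
  let ?z = "pow_diff x"
  have plus: "env_class G ?z \<in> Env_plus G" "env_class G (free_var y) \<in> Env_plus G" for y
    using pow_diff_plus free_plus_var by (simp_all add: free_plus_def del: pow_diff_plus free_plus_var)
  have "h (env_class G ?z) \<in> grade M 0"
    using h plus pow_diff_grade[OF assms(2)] by (auto simp: even_linear_cochain_def env_grade_def)
  moreover have "act y (- m) = - act y m" for y m by (rule act_minus_right)
  moreover have "Phi_cochain G (\<lambda>s t. b s t + g s t) x y =
      - act y (h (env_class G ?z)) + obstruction x y" for y
  proof -
    have "Phi_cochain G (\<lambda>s t. b s t + g s t) x y =
        b (env_class G ?z) (env_class G (free_var y)) - b (env_class G (free_var y)) (env_class G ?z)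
        + obstruction x y"
      by (simp add: Phi_cochain_def Let_def env_class_pow_diff env_in_def
          obstruction_def coc_def)
    then show ?thesis
      by (simp add: b plus env_act_class free_act_pow_diff[OF assms(2)]
          env_class_mult[symmetric] pow_diff_central[OF assms(2)])
  qed
  ultimately show ?thesis
    by (intro that[of "- h (env_class G ?z)"]) (auto simp: M.grade_minus)
qed

text \<open>\<open>Phi\<close> is a union over all cocycles of the class. One direction looks at the
  member g itself; in the other, all members give cochains differing from the obstruction by
  elements of B^1.\<close>

lemma Phi_eq_one_iff:
  "Phi G M act (H2_class G M act g) = \<one>\<^bsub>semilinear_H1 G M act\<^esub> \<longleftrightarrow>
    (\<forall>x\<in>grade G 0. obstruction x \<in> B1 M act)"
proof -
  have "Phi G M act (H2_class G M act g) = \<one>\<^bsub>semilinear_H1 G M act\<^esub> \<longleftrightarrow>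
    (\<forall>x\<in>grade G 0. (\<Union>g'\<in>H2_class G M act g. H1_class G M act (Phi_cochain G g' x)) = B1 M act)"
    by (simp only: Phi_def semilinear_H1_def H1_def one_FactGroup monoid.simps restrict_eq_iff)
  also have "\<dots> \<longleftrightarrow> (\<forall>x\<in>grade G 0. obstruction x \<in> B1 M act)"
  proof (intro ball_cong refl iffI)
    fix x assume x: "x \<in> grade G 0"
      and eq: "(\<Union>g'\<in>H2_class G M act g. H1_class G M act (Phi_cochain G g' x)) = B1 M act"
    have "obstruction x \<in> H1_class G M act (obstruction x)"
      unfolding H1_class_eq by (intro CollectI exI[of _ "\<lambda>x. 0"]) (simp add: zero_in_B1)
    then have "obstruction x \<in> (\<Union>g'\<in>H2_class G M act g. H1_class G M act (Phi_cochain G g' x))"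
      unfolding Phi_cochain_eq[symmetric] by (rule UN_I[OF self_in_H2_class])
    then show "obstruction x \<in> B1 M act" unfolding eq .
  next
    fix x assume x: "x \<in> grade G 0" and ob: "obstruction x \<in> B1 M act"
    have "H1_class G M act (Phi_cochain G g' x) = B1 M act" if g': "g' \<in> H2_class G M act g" for g'
    proof -
      obtain b where b: "b \<in> B2 G M act" and g'_eq: "g' = (\<lambda>s t. b s t + g s t)"
        using g' unfolding H2_class_eq by blast
      obtain m where "m \<in> grade M 0" "Phi_cochain G g' x = (\<lambda>y. act y m + obstruction x y)"
        unfolding g'_eq using Phi_cochain_coboundary[OF b x] .
      then have "Phi_cochain G g' x \<in> H1_class G M act (obstruction x)"
        unfolding H1_class_eq by (intro CollectI exI[of _ "\<lambda>y. act y m"]) (simp add: B1_I)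
      then show ?thesis unfolding H1_class_B1[OF ob] by (rule H1_class_B1)
    qed
    then have "(\<Union>g'\<in>H2_class G M act g. H1_class G M act (Phi_cochain G g' x)) =
        (\<Union>g'\<in>H2_class G M act g. B1 M act)" by (rule SUP_cong[OF refl])
    \<comment> \<open>A union of copies of one set is that set only over a nonempty index set; g
      itself is an index.\<close>
    also have "\<dots> = B1 M act"
      using self_in_H2_class unfolding UN_constant by (metis empty_iff)
    finally show "(\<Union>g'\<in>H2_class G M act g. H1_class G M act (Phi_cochain G g' x)) = B1 M act" .
  qed
  finally show ?thesis .
qed

end

section \<open>From restricted extensions to primitives and back\<close>

lemma obstruction_of_restricted_extension:
  fixes G :: "('k::field, 'g::ab_group_add, 'y) restricted_lie_super_scheme"
    and M :: "('k, 'm::ab_group_add, 'z) restricted_lie_super_scheme"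
    and F :: "('k, 'e::ab_group_add, 'w) restricted_lie_super_scheme"
  assumes "restricted_module_cocycle G M act g"
    and ext: "restricted_extension G M act F i \<phi>"
    and equiv: "equivalent_extensions (cocycle_ext G M act g) (\<lambda>m. (0, m)) fst F i \<phi>"
    and x: "x \<in> grade G 0"
  shows "restricted_module_cocycle.obstruction G g x \<in> B1 M act"
proof -
  interpret restricted_module_cocycle G M act g by fact
  interpret F: restricted_lie_superalgebra F using ext by (simp add: restricted_extension_def)
  obtain \<alpha> where bij: "bij \<alpha>" and hom: "lie_super_hom E F \<alpha>" and \<phi>: "\<And>e. \<phi> (\<alpha> e) = fst e"
    using equiv by (auto simp: equivalent_extensions_def fun_eq_iff)
  have lin: "Vector_Spaces.linear (scl E) (scl F) \<alpha>"
    and even: "\<And>a u. u \<in> grade E a \<Longrightarrow> \<alpha> u \<in> grade F a"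
    and brkt: "\<And>u v. \<alpha> (brkt E u v) = brkt F (\<alpha> u) (\<alpha> v)"
    using hom by (auto simp: lie_super_hom_def even_linear_def simp del: E_simps)
  have u: "(x, 0) \<in> grade E 0" using x by simp
  define e where "e = \<alpha> (x, 0)"
  have e: "e \<in> grade F 0" unfolding e_def by (rule even[OF u])
  \<comment> \<open>The p-th power in \<open>F\<close> of the lift of x, carried back to E_g. Its
    \<open>M\<close>-component will give the primitive \<open>frob (x, 0) - snd w\<close>.\<close>
  obtain w where w: "\<alpha> w = pmap F e" using bij_is_surj[OF bij] by (metis surjD)
  have inj: "u = v" if "\<alpha> u = \<alpha> v" for u v using bij_is_inj[OF bij] that by (rule injD)
  have fst_w: "fst w = pmap G x"
    using ext e \<phi>[of w] \<phi>[of "(x, 0)"] by (simp add: restricted_extension_def w e_def)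
  \<comment> \<open>\<alpha> is known to preserve degrees, but its inverse is not. So w is shown to
    be even by mapping its odd component into both degrees of \<open>F\<close>, where only 0
    lies.\<close>
  have "\<alpha> (component E 1 w) = \<alpha> w - \<alpha> (component E 0 w)"
    using linear_additive[OF lin, of "component E 0 w" "component E 1 w"]
    by (simp only: E.component_sum) simp
  also have "\<dots> \<in> grade F 0"
    unfolding w by (intro F.grade_diff F.pmap_even e even E.component_grade)
  finally have "\<alpha> (component E 1 w) = 0"
    using F.grade_both[of _ 1] even[OF E.component_grade, of 1 w] by simp
  moreover have "\<alpha> 0 = 0" using linear_additive[OF lin, of 0 0] by simp
  ultimately have "component E 1 w = 0" by (intro inj) simp
  then have "w \<in> grade E 0"
    using E.component_sum[of w] E.component_grade[of 0 w] by simp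
  then have snd_w: "snd w \<in> grade M 0" by auto
  have "\<alpha> ((brkt E (x, 0) ^^ n) v) = (brkt F e ^^ n) (\<alpha> v)" for n v
    by (induction n) (simp_all add: brkt e_def)
  then have "\<alpha> ((brkt E (x, 0) ^^ CHAR('k)) v) = \<alpha> (brkt E w v)" for v
    by (simp add: brkt w F.brkt_pmap[OF e])
  then have "(brkt E (x, 0) ^^ CHAR('k)) v = brkt E w v" for v by (rule inj)
  moreover have "w = (pmap G x, snd w)" using fst_w by (simp add: prod_eq_iff)
  ultimately have "(brkt E (x, 0) ^^ CHAR('k)) v = brkt E (pmap G x, snd w) v" for v by metis
  then have "obstruction x y = act y (frob (x, 0) - snd w)" for y
    using ad_power_char_iff[OF x M.grade_0 snd_w, of "(y, 0)"] by simp
  then have "obstruction x = (\<lambda>y. act y (frob (x, 0) - snd w))" by (simp add: fun_eq_iff)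
  then show ?thesis using B1_I[OF M.grade_diff[OF frob_grade[OF u] snd_w]] by simp
qed

lemma restricted_extension_of_obstruction:
  fixes G :: "('k::field, 'g::ab_group_add, 'y) restricted_lie_super_scheme"
    and M :: "('k, 'm::ab_group_add, 'z) restricted_lie_super_scheme"
  assumes "restricted_module_cocycle G M act g"
    and p: "CHAR('k) > 1" and abelian: "strongly_abelian M"
    and ob: "\<And>x. x \<in> grade G 0 \<Longrightarrow> restricted_module_cocycle.obstruction G g x \<in> B1 M act"
  obtains F :: "('k, 'g \<times> 'm) restricted_lie_super" where
    "restricted_extension G M act F (\<lambda>m. (0, m)) fst"
    "equivalent_extensions (cocycle_ext G M act g) (\<lambda>m. (0, m)) fst F (\<lambda>m. (0, m)) fst"
proof -
  interpret restricted_module_cocycle G M act g by fact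
  obtain c where c: "\<And>x. x \<in> grade G 0 \<Longrightarrow> c x \<in> grade M 0"
    "\<And>x y. x \<in> grade G 0 \<Longrightarrow> obstruction x y = act y (c x)"
    "\<And>x y. c (x + y) = c x + c y" "\<And>a x. c (scl G a x) = scl M (a ^ CHAR('k)) (c x)"
    using semilinear_primitive ob by blast
  let ?F = "restricted_E c"
  interpret F: restricted_lie_superalgebra ?F
    using c by (rule restricted_lie_superalgebra_E)
  note [simp] = restricted_E_sel
  have c0: "c 0 = 0" using c(3)[of 0 0] by simp
  have brkt_M: "brkt M m n = 0" for m n using abelian by (simp add: strongly_abelian_def)
  have "pmap G 0 = 0"
    using G.pmap_scl[of 0 0] char_pos by (simp add: zero_power)
  have "lie_super_hom M ?F (\<lambda>m. (0, m))"
    unfolding lie_super_hom_def even_linear_def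
  proof (intro conjI allI)
    show "Vector_Spaces.linear (scl M) (scl ?F) (\<lambda>m. (0, m))"
      by unfold_locales simp_all
  qed (auto simp: brkt_M brkt_E_ideal zero_prod_def)
  moreover have "lie_super_hom ?F G fst"
    unfolding lie_super_hom_def even_linear_def
  proof (intro conjI allI)
    show "Vector_Spaces.linear (scl ?F) (scl G) fst"
      by unfold_locales simp_all
  qed (auto simp: fst_brkt_E)
  moreover have "{e. fst e = 0} = range (\<lambda>m. (0 :: 'g, m :: 'm))" by auto
  ultimately have "extension G M act ?F (\<lambda>m. (0, m)) fst"
    using F.lie_superalgebra_axioms by (simp add: extension_def inj_on_def brkt_E_ideal)
  \<comment> \<open>On (0, m) the p-map is (0, frob (0, m) - c 0) = 0, which agrees with the zero
    p-map of \<open>M\<close>.\<close>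
  then have "restricted_extension G M act ?F (\<lambda>m. (0, m)) fst"
    using F.restricted_lie_superalgebra_axioms abelian p
    by (simp add: restricted_extension_def strongly_abelian_def frob_ideal c0 \<open>pmap G 0 = 0\<close>)
  moreover have "equivalent_extensions E (\<lambda>m. (0, m)) fst ?F (\<lambda>m. (0, m)) fst"
    unfolding equivalent_extensions_def
  proof (intro exI[of _ id] conjI)
    have "Vector_Spaces.linear (scl E) (scl ?F) id"
      by unfold_locales simp_all
    then show "lie_super_hom E ?F id"
      by (auto simp: lie_super_hom_def even_linear_def)
  qed simp_all
  ultimately show ?thesis by (rule that)
qed

theorem proposition4p4:
  fixes G :: "('k::field, 'g::ab_group_add) restricted_lie_super"
    and M :: "('k, 'm::ab_group_add) restricted_lie_super"
    and act :: "'g \<Rightarrow> 'm \<Rightarrow> 'm"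
  assumes "CHAR('k) > 2"
    and "restricted_lie_superalgebra G"
    and "restricted_lie_superalgebra M"
    and "strongly_abelian M"
    and "restricted_module G M act"
  shows "H2_0 G M act = kernel (H2 G M act) (semilinear_H1 G M act) (Phi G M act)"
proof -
  have cocycle: "restricted_module_cocycle G M act g" if "g \<in> carrier (Z2 G M act)" for g
    using assms(1,5) that restricted_module.axioms(2)[OF assms(5)]
    by (intro restricted_module_cocycle.intro restricted_module_cocycle_axioms.intro
        module_cocycle.intro module_cocycle_axioms.intro) simp_all
  define R where "R g \<longleftrightarrow> (\<exists>(F :: ('k, 'g \<times> 'm) restricted_lie_super) i \<phi>.
      restricted_extension G M act F i \<phi> \<and>
      equivalent_extensions (cocycle_ext G M act g) (\<lambda>m. (0, m)) fst F i \<phi>)" for g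
  have Phi: "Phi G M act (H2_class G M act g) = \<one>\<^bsub>semilinear_H1 G M act\<^esub> \<longleftrightarrow> R g"
    if g: "g \<in> carrier (Z2 G M act)" for g
    unfolding restricted_module_cocycle.Phi_eq_one_iff[OF cocycle[OF g]]
  proof
    assume "\<forall>x\<in>grade G 0. restricted_module_cocycle.obstruction G g x \<in> B1 M act"
    then obtain F :: "('k, 'g \<times> 'm) restricted_lie_super" where
      "restricted_extension G M act F (\<lambda>m. (0, m)) fst"
      "equivalent_extensions (cocycle_ext G M act g) (\<lambda>m. (0, m)) fst F (\<lambda>m. (0, m)) fst"
      using restricted_extension_of_obstruction[OF cocycle[OF g] _ assms(4)] assms(1)
      by (metis One_nat_def Suc_1 Suc_lessD)
    then show "R g" unfolding R_def by blast
  next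
    assume "R g"
    then show "\<forall>x\<in>grade G 0. restricted_module_cocycle.obstruction G g x \<in> B1 M act"
      unfolding R_def using obstruction_of_restricted_extension[OF cocycle[OF g]] by blast
  qed
  have "H2_0 G M act = {H2_class G M act g | g. g \<in> carrier (Z2 G M act) \<and> R g}"
    unfolding H2_0_def R_def ..
  \<comment> \<open>\<open>R\<close> is a condition on a representative; by \<open>Phi\<close> it
    depends only on the class, so the set can be described by classes.\<close>
  also have "\<dots> = {C \<in> H2_class G M act ` carrier (Z2 G M act).
      Phi G M act C = \<one>\<^bsub>semilinear_H1 G M act\<^esub>}"
    using Phi by blast
  also have "\<dots> = kernel (H2 G M act) (semilinear_H1 G M act) (Phi G M act)"
    by (simp add: kernel_def H2_def carrier_FactGroup H2_class_def[abs_def])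
  finally show ?thesis .
qed

end
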